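(* Let $R$ be a complete Noetherian local ring. Let $\mathrm{cl}$ be a residual closure operation on pairs of modules $L\subseteq M$ in a class $\mathcal{M}$ of Matlis-dualizable $R$-modules that is closed under taking submodules and quotient modules, and set $\alpha(M):=0^{\mathrm{cl}}_M$ for any $M\in\mathcal{M}$. Then for any $A\subseteq B$ in $\mathcal{M}^\vee$, $$\alpha^{\smile}(A)=A^B_{\mathrm{cl}^{\smile}}.$$
   Context: Let $(R,\mathfrak{m},k)$ be a complete Noetherian local ring, $E=E_R(k)$, $(-)^\vee=\mathrm{Hom}_R(-,E)$. A module $M$ is Matlis-dualizable if the natural map $M\to M^{\vee\vee}$ is an isomorphism (then $M^{\vee\vee}$ is identified with $M$). Classes of modules are closed under isomorphism, and $\mathcal{M}^\vee=\{M^\vee: M\in\mathcal{M}\}$ (up to isomorphism). For $A\subseteq B$, $(B/A)^\vee$ is regarded as a submodule of $B^\vee$. A closure operation $\mathrm{cl}$ on $\mathcal{M}$ assigns to each pair $L\subseteq M$ with $M\in\mathcal{M}$ a submodule $L^{\mathrm{cl}}_M$ of $M$, compatibly with isomorphisms, such that $L\subseteq L^{\mathrm{cl}}_M$; $L\subseteq N\subseteq M$ implies $L^{\mathrm{cl}}_M\subseteq N^{\mathrm{cl}}_M$; and $(L^{\mathrm{cl}}_M)^{\mathrm{cl}}_M=L^{\mathrm{cl}}_M$. It is residual if for all $L\subseteq N\subseteq M$, $N^{\mathrm{cl}}_M=\pi^{-1}\left((N/L)^{\mathrm{cl}}_{M/L}\right)$, where $\pi:M\twoheadrightarrow M/L$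 is the natural surjection. For $A\in\mathcal{M}^\vee$, $\alpha^{\smile}(A):=\left(A^\vee/\alpha(A^\vee)\right)^\vee$, regarded as a submodule of $A^{\vee\vee}=A$. For $A\subseteq B$ in $\mathcal{M}^\vee$, $$A^B_{\mathrm{cl}^{\smile}}:=\left(\frac{B^\vee}{\left((B/A)^\vee\right)^{\mathrm{cl}}_{B^\vee}}\right)^\vee,$$ regarded as a submodule of $B^{\vee\vee}=B$. *)

theory Defs
  imports "HOL-Algebra.Module" "HOL-Algebra.Ideal_Product" "HOL-Algebra.Ring_Divisibility"
begin

section \<open>Modules\<close>

text \<open>
  Only the additive group and the scalar multiplication of a \<open>module\<close> record matter; its
  ring fields \<open>mult\<close> and \<open>one\<close> are junk.
\<close>

definition mod_hom ::
    "('r, 'x) ring_scheme \<Rightarrow> ('r, 'm, 'y) module_scheme \<Rightarrow> ('r, 'n, 'z) module_scheme \<Rightarrow> ('m \<Rightarrow> 'n) set"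
  where "mod_hom R M N =
    {f \<in> hom (add_monoid M) (add_monoid N).
      \<forall>r\<in>carrier R. \<forall>x\<in>carrier M. f (r \<odot>\<^bsub>M\<^esub> x) = r \<odot>\<^bsub>N\<^esub> f x}"

definition mod_iso ::
    "('r, 'x) ring_scheme \<Rightarrow> ('r, 'm, 'y) module_scheme \<Rightarrow> ('r, 'n, 'z) module_scheme \<Rightarrow> ('m \<Rightarrow> 'n) set"
  where "mod_iso R M N = {f \<in> mod_hom R M N. bij_betw f (carrier M) (carrier N)}"

text \<open>The ring as a module over itself.\<close>

definition regular_module :: "('r, 'x) ring_scheme \<Rightarrow> ('r, 'r) module"
  where "regular_module R =
    \<lparr>carrier = carrier R, monoid.mult = monoid.mult R, one = one R, ring.zero = ring.zero R, add = add R,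
     smult = monoid.mult R\<rparr>"

definition quot_module ::
    "('r, 'x) ring_scheme \<Rightarrow> ('r, 'm, 'y) module_scheme \<Rightarrow> 'm set \<Rightarrow> ('r, 'm set) module"
  where "quot_module R M L =
    \<lparr>carrier = a_rcosets\<^bsub>M\<^esub> L, monoid.mult = undefined, one = undefined, ring.zero = L, add = set_add M,
     smult = (\<lambda>r X. \<Union>x\<in>X. L +>\<^bsub>M\<^esub> (r \<odot>\<^bsub>M\<^esub> x))\<rparr>"

text \<open>
  \<open>Hom\<^sub>R(M, N)\<close>.  Homomorphisms are taken extensional on the carrier of \<open>M\<close>, so that
  HOL equality of elements is equality of maps.
\<close>

definition Hom_module ::
    "('r, 'x) ring_scheme \<Rightarrow> ('r, 'm, 'y) module_scheme \<Rightarrow> ('r, 'n, 'z) module_scheme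
      \<Rightarrow> ('r, 'm \<Rightarrow> 'n) module"
  where "Hom_module R M N =
    \<lparr>carrier = mod_hom R M N \<inter> extensional (carrier M), monoid.mult = undefined, one = undefined,
     ring.zero = (\<lambda>x\<in>carrier M. \<zero>\<^bsub>N\<^esub>),
     add = (\<lambda>f g. \<lambda>x\<in>carrier M. f x \<oplus>\<^bsub>N\<^esub> g x),
     smult = (\<lambda>r f. \<lambda>x\<in>carrier M. r \<odot>\<^bsub>N\<^esub> f x)\<rparr>"


section \<open>Complete Noetherian local rings\<close>

definition local_ring :: "('r, 'x) ring_scheme \<Rightarrow> 'r set \<Rightarrow> bool"
  where "local_ring R \<mm> \<longleftrightarrow>
    cring R \<and> maximalideal \<mm> R \<and> (\<forall>J. maximalideal J R \<longrightarrow> J = \<mm>)"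

definition ideal_power :: "('r, 'x) ring_scheme \<Rightarrow> 'r set \<Rightarrow> nat \<Rightarrow> 'r set"
  where "ideal_power R I n = ((\<lambda>J. ideal_prod R I J) ^^ n) (carrier R)"

text \<open>
  The canonical map from \<open>R\<close> to the inverse limit of the rings \<open>R/I\<^sup>n\<close> is bijective.  A
  compatible family is a sequence of cosets \<open>c n\<close> of \<open>I\<^sup>n\<close>; the transition map sends
  \<open>c (Suc n)\<close> to the unique coset of \<open>I\<^sup>n\<close> that contains it.
\<close>

definition adically_complete :: "('r, 'x) ring_scheme \<Rightarrow> 'r set \<Rightarrow> bool"
  where "adically_complete R I \<longleftrightarrow>
    bij_betw (\<lambda>r n. ideal_power R I n +>\<^bsub>R\<^esub> r) (carrier R)
      {c. \<forall>n. c n \<in> carrier (R Quot ideal_power R I n) \<and> c (Suc n) \<subseteq> c n}"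

definition complete_noetherian_local_ring :: "('r, 'x) ring_scheme \<Rightarrow> 'r set \<Rightarrow> bool"
  where "complete_noetherian_local_ring R \<mm> \<longleftrightarrow>
    local_ring R \<mm> \<and> noetherian_ring R \<and> adically_complete R \<mm>"

definition residue_field_module :: "('r, 'x) ring_scheme \<Rightarrow> 'r set \<Rightarrow> ('r, 'r set) module"
  where "residue_field_module R \<mm> = quot_module R (regular_module R) \<mm>"


section \<open>Injective modules and injective hulls\<close>

text \<open>
  HOL cannot quantify over all types inside a definition, so the type \<open>'n\<close> of the carriers of the
  test modules is a parameter.  Nothing is lost by testing on modules whose carrier lives in the
  type of the ring: by Baer's criterion the extension property then holds for test modules of
  every type (lemma \<open>injective_module_all_types\<close>).
\<close>

definition injective_module ::
    "'n itself \<Rightarrow> ('r, 'x) ring_scheme \<Rightarrow> ('r, 'e, 'y) module_scheme \<Rightarrow> bool"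
  where "injective_module _ R E \<longleftrightarrow> module R E \<and>
    (\<forall>(N :: ('r, 'n) module) M g.
      module R N \<longrightarrow> submodule M R N \<longrightarrow> g \<in> mod_hom R (N\<lparr>carrier := M\<rparr>) E \<longrightarrow>
      (\<exists>h\<in>mod_hom R N E. \<forall>x\<in>M. h x = g x))"

lemma regular_module_module: "cring R \<Longrightarrow> module R (regular_module R)"
proof -
  assume "cring R"
  then interpret cring R .
  have "abelian_group (regular_module R)"
  proof (rule abelian_groupI)
    fix x assume "x \<in> carrier (regular_module R)"
    then show "\<exists>y\<in>carrier (regular_module R). y \<oplus>\<^bsub>regular_module R\<^esub> x = \<zero>\<^bsub>regular_module R\<^esub>"
      using l_neg by (intro bexI[of _ "\<ominus>\<^bsub>R\<^esub> x"]) (auto simp: regular_module_def)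
  qed (auto simp: regular_module_def a_ac)
  then show ?thesis
    by (intro moduleI \<open>cring R\<close>) (auto simp: regular_module_def l_distr r_distr m_assoc)
qed

theorem injective_module_all_types:
  fixes R :: "('r, 'x) ring_scheme" and E :: "('r, 'e, 'y) module_scheme"
  assumes inj: "injective_module TYPE('r) R E"
  shows "injective_module TYPE('n) R E"
  unfolding injective_module_def
proof (intro conjI allI impI)
  show modE: "module R E" using inj by (simp add: injective_module_def)
  fix N :: "('r, 'n) module" and M g
  assume modN: "module R N" and sub: "submodule M R N"
    and g: "g \<in> mod_hom R (N\<lparr>carrier := M\<rparr>) E"
  interpret E: module R E by fact
  interpret N: module R N by fact
  note sM = N.submoduleE[OF sub]
  have g_car: "g x \<in> carrier E" if "x \<in> M" for x
    using g that by (auto simp: mod_hom_def hom_def)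
  have g_add: "g (x \<oplus>\<^bsub>N\<^esub> y) = g x \<oplus>\<^bsub>E\<^esub> g y" if "x \<in> M" "y \<in> M" for x y
    using g that by (auto simp: mod_hom_def hom_def)
  have g_smult: "g (r \<odot>\<^bsub>N\<^esub> x) = r \<odot>\<^bsub>E\<^esub> g x" if "x \<in> M" "r \<in> carrier R" for x r
    using g that by (auto simp: mod_hom_def hom_def)
  have zero_M: "\<zero>\<^bsub>N\<^esub> \<in> M"
    using sM N.smult_l_null by (metis E.R.zero_closed all_not_in_conv subsetD)
  have g_zero: "g \<zero>\<^bsub>N\<^esub> = \<zero>\<^bsub>E\<^esub>"
    using g_smult[OF zero_M E.R.zero_closed] g_car[OF zero_M] by simp
  define gr where "gr = (\<lambda>x. (x, g x)) ` M"
  define \<G> where "\<G> = {G. gr \<subseteq> G \<and> G \<subseteq> carrier N \<times> carrier E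
    \<and> (\<forall>a e b f. (a, e) \<in> G \<longrightarrow> (b, f) \<in> G \<longrightarrow> (a \<oplus>\<^bsub>N\<^esub> b, e \<oplus>\<^bsub>E\<^esub> f) \<in> G)
    \<and> (\<forall>r\<in>carrier R. \<forall>a e. (a, e) \<in> G \<longrightarrow> (r \<odot>\<^bsub>N\<^esub> a, r \<odot>\<^bsub>E\<^esub> e) \<in> G)
    \<and> (\<forall>e. (\<zero>\<^bsub>N\<^esub>, e) \<in> G \<longrightarrow> e = \<zero>\<^bsub>E\<^esub>)}"
  have \<G>_gr: "gr \<subseteq> G" and \<G>_car: "G \<subseteq> carrier N \<times> carrier E"
    and \<G>_add: "(a, e) \<in> G \<Longrightarrow> (b, f) \<in> G \<Longrightarrow> (a \<oplus>\<^bsub>N\<^esub> b, e \<oplus>\<^bsub>E\<^esub> f) \<in> G"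
    and \<G>_smult: "r \<in> carrier R \<Longrightarrow> (a, e) \<in> G \<Longrightarrow> (r \<odot>\<^bsub>N\<^esub> a, r \<odot>\<^bsub>E\<^esub> e) \<in> G"
    and \<G>_zero: "(\<zero>\<^bsub>N\<^esub>, e) \<in> G \<Longrightarrow> e = \<zero>\<^bsub>E\<^esub>" if "G \<in> \<G>" for G a b e f r
    using that by (simp_all add: \<G>_def)
  have gr_in: "gr \<in> \<G>"
    unfolding \<G>_def gr_def using sM g_car g_add g_smult g_zero by auto
  have "\<exists>G\<in>\<G>. \<forall>X\<in>\<G>. G \<subseteq> X \<longrightarrow> X = G"
  proof (rule subset_Zorn_nonempty)
    show "\<G> \<noteq> {}" using gr_in by blast
    fix \<C> assume ne: "\<C> \<noteq> {}" and chain: "subset.chain \<G> \<C>"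
    have sub\<G>: "G \<in> \<G>" if "G \<in> \<C>" for G
      using chain that by (auto simp: subset_chain_def)
    have add: "(a \<oplus>\<^bsub>N\<^esub> b, e \<oplus>\<^bsub>E\<^esub> f) \<in> \<Union>\<C>"
      if ae: "(a, e) \<in> \<Union>\<C>" and bf: "(b, f) \<in> \<Union>\<C>" for a e b f
    proof -
      obtain G1 G2 where G1: "G1 \<in> \<C>" "(a, e) \<in> G1" and G2: "G2 \<in> \<C>" "(b, f) \<in> G2"
        using ae bf by (elim UnionE)
      then have "G1 \<subseteq> G2 \<or> G2 \<subseteq> G1" using chain by (simp add: subset_chain_def)
      then obtain G where "G \<in> \<C>" "(a, e) \<in> G" "(b, f) \<in> G"
        using G1 G2 by (elim disjE) (simp_all add: subsetD)
      then show ?thesis using \<G>_add[OF sub\<G>] by (intro UnionI)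
    qed
    have smult: "(r \<odot>\<^bsub>N\<^esub> a, r \<odot>\<^bsub>E\<^esub> e) \<in> \<Union>\<C>"
      if "r \<in> carrier R" "(a, e) \<in> \<Union>\<C>" for r a e
      using that \<G>_smult[OF sub\<G>] by (elim UnionE) (intro UnionI)
    obtain G0 where "G0 \<in> \<C>" using ne by (meson ex_in_conv)
    then have "gr \<subseteq> \<Union>\<C>" using \<G>_gr[OF sub\<G>] by (meson Union_upper order_trans)
    moreover have "\<Union>\<C> \<subseteq> carrier N \<times> carrier E"
      using \<G>_car[OF sub\<G>] by (rule Union_least)
    moreover have "e = \<zero>\<^bsub>E\<^esub>" if "(\<zero>\<^bsub>N\<^esub>, e) \<in> \<Union>\<C>" for e
      using that \<G>_zero[OF sub\<G>] by (elim UnionE)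
    ultimately show "\<Union>\<C> \<in> \<G>"
      unfolding \<G>_def using add smult by (intro CollectI conjI allI impI ballI)
  qed
  then obtain G where G: "G \<in> \<G>" and max: "\<And>X. X \<in> \<G> \<Longrightarrow> G \<subseteq> X \<Longrightarrow> X = G" by blast
  note G_gr = \<G>_gr[OF G] and G_add = \<G>_add[OF G] and G_smult = \<G>_smult[OF G]
    and G_zero = \<G>_zero[OF G]
  have G_car: "a \<in> carrier N \<and> e \<in> carrier E" if "(a, e) \<in> G" for a e
    using \<G>_car[OF G] that by auto
  have G_neg: "(\<ominus>\<^bsub>N\<^esub> a, \<ominus>\<^bsub>E\<^esub> e) \<in> G" if "(a, e) \<in> G" for a e
    using G_smult[of "\<ominus>\<^bsub>R\<^esub> \<one>\<^bsub>R\<^esub>", OF _ that] G_car[OF that]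
    by (simp add: N.smult_l_minus E.smult_l_minus)
  have G_fun: "e = f" if "(a, e) \<in> G" "(a, f) \<in> G" for a e f
  proof -
    have "(a \<oplus>\<^bsub>N\<^esub> \<ominus>\<^bsub>N\<^esub> a, e \<oplus>\<^bsub>E\<^esub> \<ominus>\<^bsub>E\<^esub> f) \<in> G" using G_add[OF that(1) G_neg[OF that(2)]] .
    then have "e \<oplus>\<^bsub>E\<^esub> \<ominus>\<^bsub>E\<^esub> f = \<zero>\<^bsub>E\<^esub>" using G_zero G_car that by (simp add: N.M.r_neg)
    then show ?thesis using G_car that by (metis E.M.minus_equality E.M.minus_minus E.a_inv_closed E.M.a_comm)
  qed
  have G_0: "(\<zero>\<^bsub>N\<^esub>, \<zero>\<^bsub>E\<^esub>) \<in> G"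
    using G_gr zero_M g_zero unfolding gr_def by force
  have dom: "\<exists>e. (x, e) \<in> G" if x: "x \<in> carrier N" for x
  proof (rule ccontr)
    assume nx: "\<nexists>e. (x, e) \<in> G"
    define I where "I = {r \<in> carrier R. \<exists>e. (r \<odot>\<^bsub>N\<^esub> x, e) \<in> G}"
    define u where "u r = (THE e. (r \<odot>\<^bsub>N\<^esub> x, e) \<in> G)" for r
    have u: "(r \<odot>\<^bsub>N\<^esub> x, u r) \<in> G" if "r \<in> I" for r
      unfolding u_def by (rule theI') (use that G_fun in \<open>auto simp: I_def\<close>)
    have u_eq: "u r = e" if "(r \<odot>\<^bsub>N\<^esub> x, e) \<in> G" for r e
      unfolding u_def using that G_fun by blast
    have I_car: "I \<subseteq> carrier R" by (auto simp: I_def)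
    have Iadd: "((r \<oplus>\<^bsub>R\<^esub> s) \<odot>\<^bsub>N\<^esub> x, u r \<oplus>\<^bsub>E\<^esub> u s) \<in> G" if "r \<in> I" "s \<in> I" for r s
      using G_add[OF u[OF that(1)] u[OF that(2)]] that I_car x by (auto simp: N.smult_l_distr subset_iff)
    have Imul: "((r \<otimes>\<^bsub>R\<^esub> s) \<odot>\<^bsub>N\<^esub> x, r \<odot>\<^bsub>E\<^esub> u s) \<in> G" if "r \<in> carrier R" "s \<in> I" for r s
      using G_smult[OF that(1) u[OF that(2)]] that I_car x by (auto simp: N.smult_assoc1 subset_iff)
    interpret RR: module R "regular_module R"
      by (rule regular_module_module) (rule E.R.cring_axioms)
    have RR_simps: "carrier (regular_module R) = carrier R" "ring.zero (regular_module R) = ring.zero R"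
      "add (regular_module R) = add R" "smult (regular_module R) = monoid.mult R"
      by (simp_all add: regular_module_def)
    have RR_inv: "\<ominus>\<^bsub>regular_module R\<^esub> r = \<ominus>\<^bsub>R\<^esub> r" if "r \<in> carrier R" for r
      by (rule RR.M.minus_equality) (simp_all add: RR_simps E.R.l_neg that)
    have neg: "\<ominus>\<^bsub>R\<^esub> r \<in> I" if "r \<in> I" for r
      using G_neg[OF u[OF that]] that I_car x by (auto simp: I_def N.smult_l_minus)
    have addI: "r \<oplus>\<^bsub>R\<^esub> s \<in> I" if "r \<in> I" "s \<in> I" for r s
      using Iadd[OF that] that by (auto simp: I_def)
    have mulI: "r \<otimes>\<^bsub>R\<^esub> s \<in> I" if "r \<in> carrier R" "s \<in> I" for r s
      using Imul[OF that] that by (auto simp: I_def)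
    have zeroI: "\<zero>\<^bsub>R\<^esub> \<in> I"
      using G_0 x by (auto simp: I_def)
    have "submodule I R (regular_module R)"
      by (rule RR.submoduleI)
        (use I_car zeroI neg addI mulI in \<open>auto simp: RR_simps RR_inv subset_iff\<close>)
    moreover have "u \<in> mod_hom R ((regular_module R)\<lparr>carrier := I\<rparr>) E"
      using u G_car u_eq[OF Iadd] u_eq[OF Imul] by (auto simp: mod_hom_def hom_def RR_simps)
    ultimately obtain h where h: "h \<in> mod_hom R (regular_module R) E" and hu: "\<And>r. r \<in> I \<Longrightarrow> h r = u r"
      using inj RR.module_axioms unfolding injective_module_def by blast
    have h_car: "h r \<in> carrier E" if "r \<in> carrier R" for r
      using h that by (auto simp: mod_hom_def hom_def RR_simps)
    have h_add: "h (r \<oplus>\<^bsub>R\<^esub> s) = h r \<oplus>\<^bsub>E\<^esub> h s" if "r \<in> carrier R" "s \<in> carrier R" for r s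
      using h that by (auto simp: mod_hom_def hom_def RR_simps)
    have h_mul: "h (r \<otimes>\<^bsub>R\<^esub> s) = r \<odot>\<^bsub>E\<^esub> h s" if "r \<in> carrier R" "s \<in> carrier R" for r s
      using h that by (auto simp: mod_hom_def hom_def RR_simps)
    have h_0: "h \<zero>\<^bsub>R\<^esub> = \<zero>\<^bsub>E\<^esub>"
      using h_mul[of "\<zero>\<^bsub>R\<^esub>" "\<zero>\<^bsub>R\<^esub>"] h_car by simp
    define G' where "G' = {(a \<oplus>\<^bsub>N\<^esub> r \<odot>\<^bsub>N\<^esub> x, e \<oplus>\<^bsub>E\<^esub> h r) | a e r. (a, e) \<in> G \<and> r \<in> carrier R}"
    have G'I: "(b, f) \<in> G'"
      if "(a, e) \<in> G" "r \<in> carrier R" "b = a \<oplus>\<^bsub>N\<^esub> r \<odot>\<^bsub>N\<^esub> x" "f = e \<oplus>\<^bsub>E\<^esub> h r" for a e r b f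
      using that unfolding G'_def by blast
    have GG': "G \<subseteq> G'"
      using G'I[OF _ E.R.zero_closed] G_car x h_0 by auto
    have "G' \<in> \<G>"
      unfolding \<G>_def
    proof (intro CollectI conjI allI impI ballI)
      show "gr \<subseteq> G'" using G_gr GG' by blast
      show "G' \<subseteq> carrier N \<times> carrier E" unfolding G'_def using G_car h_car x by auto
    next
      fix a e b f assume "(a, e) \<in> G'" "(b, f) \<in> G'"
      then obtain a' e' r b' f' s where
        1: "(a', e') \<in> G" "r \<in> carrier R" "a = a' \<oplus>\<^bsub>N\<^esub> r \<odot>\<^bsub>N\<^esub> x" "e = e' \<oplus>\<^bsub>E\<^esub> h r" and
        2: "(b', f') \<in> G" "s \<in> carrier R" "b = b' \<oplus>\<^bsub>N\<^esub> s \<odot>\<^bsub>N\<^esub> x" "f = f' \<oplus>\<^bsub>E\<^esub> h s"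
        unfolding G'_def by blast
      note c = G_car[OF 1(1)] G_car[OF 2(1)] h_car[OF 1(2)] h_car[OF 2(2)] x 1(2) 2(2)
      show "(a \<oplus>\<^bsub>N\<^esub> b, e \<oplus>\<^bsub>E\<^esub> f) \<in> G'"
      proof (rule G'I[OF G_add[OF 1(1) 2(1)]])
        show "r \<oplus>\<^bsub>R\<^esub> s \<in> carrier R" using c by simp
        show "a \<oplus>\<^bsub>N\<^esub> b = a' \<oplus>\<^bsub>N\<^esub> b' \<oplus>\<^bsub>N\<^esub> (r \<oplus>\<^bsub>R\<^esub> s) \<odot>\<^bsub>N\<^esub> x"
          using c 1 2 by (simp add: N.smult_l_distr N.M.a_ac)
        show "e \<oplus>\<^bsub>E\<^esub> f = e' \<oplus>\<^bsub>E\<^esub> f' \<oplus>\<^bsub>E\<^esub> h (r \<oplus>\<^bsub>R\<^esub> s)"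
          using c 1 2 by (simp add: h_add E.M.a_ac)
      qed
    next
      fix r a e assume r: "r \<in> carrier R" and "(a, e) \<in> G'"
      then obtain a' e' s where
        1: "(a', e') \<in> G" "s \<in> carrier R" "a = a' \<oplus>\<^bsub>N\<^esub> s \<odot>\<^bsub>N\<^esub> x" "e = e' \<oplus>\<^bsub>E\<^esub> h s"
        unfolding G'_def by blast
      note c = G_car[OF 1(1)] h_car[OF 1(2)] x 1(2) r
      show "(r \<odot>\<^bsub>N\<^esub> a, r \<odot>\<^bsub>E\<^esub> e) \<in> G'"
        by (rule G'I[OF G_smult[OF r 1(1)], of "r \<otimes>\<^bsub>R\<^esub> s"])
          (use c 1 in \<open>simp_all add: N.smult_r_distr E.smult_r_distr N.smult_assoc1 h_mul\<close>)
    next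
      fix e assume "(\<zero>\<^bsub>N\<^esub>, e) \<in> G'"
      then obtain a' e' s where
        1: "(a', e') \<in> G" "s \<in> carrier R" "\<zero>\<^bsub>N\<^esub> = a' \<oplus>\<^bsub>N\<^esub> s \<odot>\<^bsub>N\<^esub> x" "e = e' \<oplus>\<^bsub>E\<^esub> h s"
        unfolding G'_def by blast
      note c = G_car[OF 1(1)] h_car[OF 1(2)] x 1(2)
      have "s \<odot>\<^bsub>N\<^esub> x = \<ominus>\<^bsub>N\<^esub> a'"
        using c 1(3) by (metis N.M.a_comm N.M.minus_equality N.smult_closed)
      then have s: "(s \<odot>\<^bsub>N\<^esub> x, \<ominus>\<^bsub>E\<^esub> e') \<in> G" using G_neg[OF 1(1)] by simp
      then have "h s = \<ominus>\<^bsub>E\<^esub> e'" using hu[of s] u_eq[OF s] 1(2) by (auto simp: I_def)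
      then show "e = \<zero>\<^bsub>E\<^esub>" using 1(4) c by (simp add: E.M.r_neg)
    qed
    then have "G' = G" using max GG' by blast
    moreover have "(x, h \<one>\<^bsub>R\<^esub>) \<in> G'"
      by (rule G'I[OF G_0, of "\<one>\<^bsub>R\<^esub>"]) (use x h_car in simp_all)
    ultimately show False using nx by blast
  qed
  define h where "h x = (THE e. (x, e) \<in> G)" for x
  have h: "(x, h x) \<in> G" if "x \<in> carrier N" for x
    unfolding h_def by (rule theI') (use dom[OF that] G_fun in blast)
  have "h \<in> mod_hom R N E"
    unfolding mod_hom_def hom_def
  proof (intro CollectI conjI ballI Pi_I)
    show "h x \<in> carrier (add_monoid E)" if "x \<in> carrier (add_monoid N)" for x
      using h that G_car by auto
    show "h (x \<otimes>\<^bsub>add_monoid N\<^esub> y) = h x \<otimes>\<^bsub>add_monoid E\<^esub> h y"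
      if "x \<in> carrier (add_monoid N)" "y \<in> carrier (add_monoid N)" for x y
      using that G_fun[OF h G_add[OF h h]] by simp
    show "h (r \<odot>\<^bsub>N\<^esub> x) = r \<odot>\<^bsub>E\<^esub> h x" if "r \<in> carrier R" "x \<in> carrier N" for r x
      using that G_fun[OF h G_smult[OF _ h]] by simp
  qed
  moreover have "h x = g x" if "x \<in> M" for x
  proof (rule G_fun)
    show "(x, h x) \<in> G" using h that sM(1) by blast
    show "(x, g x) \<in> G" using G_gr that unfolding gr_def by blast
  qed
  ultimately show "\<exists>h\<in>mod_hom R N E. \<forall>x\<in>M. h x = g x" by blast
qed

definition injective_hull ::
    "('r, 'x) ring_scheme \<Rightarrow> ('r, 'k, 'z) module_scheme \<Rightarrow> ('r, 'e, 'y) module_scheme \<Rightarrow> bool"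
  where "injective_hull R K E \<longleftrightarrow>
    injective_module TYPE('r) R E \<and>
    (\<exists>\<iota>\<in>mod_hom R K E. inj_on \<iota> (carrier K) \<and>
      (\<forall>N. submodule N R E \<longrightarrow> N \<noteq> {\<zero>\<^bsub>E\<^esub>} \<longrightarrow> N \<inter> \<iota> ` carrier K \<noteq> {\<zero>\<^bsub>E\<^esub>}))"


section \<open>Matlis duality\<close>

definition matlis_dual ::
    "('r, 'x) ring_scheme \<Rightarrow> ('r, 'e, 'y) module_scheme \<Rightarrow> ('r, 'm, 'z) module_scheme
      \<Rightarrow> ('r, 'm \<Rightarrow> 'e) module"
  where "matlis_dual R E M = Hom_module R M E"

definition bidual_map ::
    "('r, 'x) ring_scheme \<Rightarrow> ('r, 'e, 'y) module_scheme \<Rightarrow> ('r, 'm, 'z) module_scheme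
      \<Rightarrow> 'm \<Rightarrow> ('m \<Rightarrow> 'e) \<Rightarrow> 'e"
  where "bidual_map R E M x = (\<lambda>f\<in>carrier (matlis_dual R E M). f x)"

definition matlis_dualizable ::
    "('r, 'x) ring_scheme \<Rightarrow> ('r, 'e, 'y) module_scheme \<Rightarrow> ('r, 'm, 'z) module_scheme \<Rightarrow> bool"
  where "matlis_dualizable R E M \<longleftrightarrow>
    bidual_map R E M \<in> mod_iso R M (matlis_dual R E (matlis_dual R E M))"

text \<open>\<open>(M/L)\<^sup>\<or>\<close> as a submodule of \<open>M\<^sup>\<or>\<close>: the image of the dual of the surjection onto \<open>M/L\<close>.\<close>

definition quot_dual ::
    "('r, 'x) ring_scheme \<Rightarrow> ('r, 'e, 'y) module_scheme \<Rightarrow> ('r, 'm, 'z) module_scheme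
      \<Rightarrow> 'm set \<Rightarrow> ('m \<Rightarrow> 'e) set"
  where "quot_dual R E M L =
    (\<lambda>f. \<lambda>x\<in>carrier M. f (L +>\<^bsub>M\<^esub> x)) ` carrier (matlis_dual R E (quot_module R M L))"

text \<open>\<open>(M\<^sup>\<or>/D)\<^sup>\<or>\<close> as a submodule of \<open>M\<close>, via the identification of \<open>M\<close> with \<open>M\<^sup>\<or>\<^sup>\<or>\<close>.\<close>

definition dual_quot_dual ::
    "('r, 'x) ring_scheme \<Rightarrow> ('r, 'e, 'y) module_scheme \<Rightarrow> ('r, 'm, 'z) module_scheme
      \<Rightarrow> ('m \<Rightarrow> 'e) set \<Rightarrow> 'm set"
  where "dual_quot_dual R E M D =
    {x \<in> carrier M. bidual_map R E M x \<in> quot_dual R E (matlis_dual R E M) D}"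


section \<open>Classes of modules and closure operations\<close>

text \<open>
  A class of modules is given by its members with carrier in an arbitrary but fixed type \<open>'u\<close>.
  Quotients and duals live in other types; being closed under isomorphism, the class is
  extended to modules over any type by the following predicate.
\<close>

definition in_class ::
    "('r, 'x) ring_scheme \<Rightarrow> ('r, 'u) module set \<Rightarrow> ('r, 'm) module \<Rightarrow> bool"
  where "in_class R \<M> N \<longleftrightarrow> module R N \<and> (\<exists>M\<in>\<M>. mod_iso R N M \<noteq> {})"

definition sub_quot_closed_class :: "('r, 'x) ring_scheme \<Rightarrow> ('r, 'u) module set \<Rightarrow> bool"
  where "sub_quot_closed_class R \<M> \<longleftrightarrow>
    (\<forall>M\<in>\<M>. module R M) \<and>
    (\<forall>N. in_class R \<M> N \<longrightarrow> N \<in> \<M>) \<and>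
    (\<forall>M\<in>\<M>. \<forall>L. submodule L R M \<longrightarrow> M\<lparr>carrier := L\<rparr> \<in> \<M>) \<and>
    (\<forall>M\<in>\<M>. \<forall>L. submodule L R M \<longrightarrow> in_class R \<M> (quot_module R M L))"

text \<open>\<open>\<M>\<^sup>\<or>\<close>, up to isomorphism.\<close>

definition in_dual_class ::
    "('r, 'x) ring_scheme \<Rightarrow> ('r, 'e, 'y) module_scheme \<Rightarrow> ('r, 'u) module set
      \<Rightarrow> ('r, 'a) module \<Rightarrow> bool"
  where "in_dual_class R E \<M> A \<longleftrightarrow>
    module R A \<and> (\<exists>M\<in>\<M>. mod_iso R A (matlis_dual R E M) \<noteq> {})"

text \<open>\<open>cl M L\<close> is the closure of \<open>L\<close> in \<open>M\<close>; only its values for \<open>M \<in> \<M>\<close> and submodules \<open>L\<close> matter.\<close>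

definition closure_operation ::
    "('r, 'x) ring_scheme \<Rightarrow> ('r, 'u) module set \<Rightarrow> (('r, 'u) module \<Rightarrow> 'u set \<Rightarrow> 'u set) \<Rightarrow> bool"
  where "closure_operation R \<M> cl \<longleftrightarrow>
    (\<forall>M\<in>\<M>. \<forall>L. submodule L R M \<longrightarrow> submodule (cl M L) R M) \<and>
    (\<forall>M\<in>\<M>. \<forall>M'\<in>\<M>. \<forall>\<phi>\<in>mod_iso R M M'. \<forall>L. submodule L R M \<longrightarrow>
      cl M' (\<phi> ` L) = \<phi> ` cl M L) \<and>
    (\<forall>M\<in>\<M>. \<forall>L. submodule L R M \<longrightarrow> L \<subseteq> cl M L) \<and>
    (\<forall>M\<in>\<M>. \<forall>L N. submodule L R M \<longrightarrow> submodule N R M \<longrightarrow> L \<subseteq> N \<longrightarrow> cl M L \<subseteq> cl M N) \<and>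
    (\<forall>M\<in>\<M>. \<forall>L. submodule L R M \<longrightarrow> cl M (cl M L) = cl M L)"

text \<open>
  The closure of \<open>L\<close> in a module \<open>N\<close> over any type that is isomorphic to a member of \<open>\<M>\<close>, obtained
  by transport along an isomorphism.  Compatibility with isomorphisms makes the choice of
  isomorphism irrelevant, and on \<open>\<M>\<close> itself this is \<open>cl\<close>.
\<close>

definition closure_in ::
    "('r, 'x) ring_scheme \<Rightarrow> ('r, 'u) module set \<Rightarrow> (('r, 'u) module \<Rightarrow> 'u set \<Rightarrow> 'u set)
      \<Rightarrow> ('r, 'm) module \<Rightarrow> 'm set \<Rightarrow> 'm set"
  where "closure_in R \<M> cl N L =
    {x \<in> carrier N. \<exists>M\<in>\<M>. \<exists>\<phi>\<in>mod_iso R N M. \<phi> x \<in> cl M (\<phi> ` L)}"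

lemma closure_in_eq:
  assumes cl: "closure_operation R \<M> cl" and M: "M \<in> \<M>" "module R M" and L: "submodule L R M"
  shows "closure_in R \<M> cl M L = cl M L"
proof -
  have "submodule (cl M L) R M"
    using cl M(1) L by (simp add: closure_operation_def)
  then have sub: "cl M L \<subseteq> carrier M"
    by (rule module.submoduleE(1)[OF M(2)])
  have iso: "cl M' (\<phi> ` L) = \<phi> ` cl M L" if "M' \<in> \<M>" "\<phi> \<in> mod_iso R M M'" for M' \<phi>
    using cl M(1) L that by (simp add: closure_operation_def)
  have id: "(\<lambda>x. x) \<in> mod_iso R M M"
    by (auto simp: mod_iso_def mod_hom_def hom_def bij_betw_def)
  show ?thesis
  proof (intro equalityI subsetI)
    fix x assume "x \<in> closure_in R \<M> cl M L"
    then obtain M' \<phi> where x: "x \<in> carrier M" "M' \<in> \<M>" "\<phi> \<in> mod_iso R M M'" "\<phi> x \<in> cl M' (\<phi> ` L)"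
      unfolding closure_in_def by blast
    have "inj_on \<phi> (carrier M)" using x(3) by (simp add: mod_iso_def bij_betw_def)
    moreover have "\<phi> x \<in> \<phi> ` cl M L" using x(4) iso[OF x(2,3)] by simp
    ultimately show "x \<in> cl M L" using x(1) sub by (simp add: inj_on_image_mem_iff)
  next
    fix x assume "x \<in> cl M L"
    then have "x \<in> carrier M" "(\<lambda>x. x) x \<in> cl M ((\<lambda>x. x) ` L)" using sub by auto
    then show "x \<in> closure_in R \<M> cl M L"
      unfolding closure_in_def by (intro CollectI conjI bexI[OF _ M(1)] bexI[OF _ id])
  qed
qed

definition residual ::
    "('r, 'x) ring_scheme \<Rightarrow> ('r, 'u) module set \<Rightarrow> (('r, 'u) module \<Rightarrow> 'u set \<Rightarrow> 'u set) \<Rightarrow> bool"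
  where "residual R \<M> cl \<longleftrightarrow>
    (\<forall>M\<in>\<M>. \<forall>L N. submodule L R M \<longrightarrow> submodule N R M \<longrightarrow> L \<subseteq> N \<longrightarrow>
      cl M N = {x \<in> carrier M.
        L +>\<^bsub>M\<^esub> x \<in> closure_in R \<M> cl (quot_module R M L) ((\<lambda>y. L +>\<^bsub>M\<^esub> y) ` N)})"

definition zero_closure ::
    "('r, 'x) ring_scheme \<Rightarrow> ('r, 'u) module set \<Rightarrow> (('r, 'u) module \<Rightarrow> 'u set \<Rightarrow> 'u set)
      \<Rightarrow> ('r, 'm) module \<Rightarrow> 'm set"
  where "zero_closure R \<M> cl M = closure_in R \<M> cl M {\<zero>\<^bsub>M\<^esub>}"

text \<open>
  The dual \<open>\<alpha>\<^sup>\<smile>(A)\<close> of \<open>\<alpha>\<close> as a submodule of \<open>A\<close>, and the dual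
  \<open>(B\<^sup>\<or> / ((B/A)\<^sup>\<or>)\<^sup>c\<^sup>l)\<^sup>\<or>\<close> of \<open>cl\<close> as a submodule of \<open>B\<close>.  Here \<open>\<alpha>\<close> and \<open>cl\<close> operate on
  modules over the type of the dual of \<open>A\<close> and of \<open>B\<close>.
\<close>

definition smile_dual ::
    "('r, 'x) ring_scheme \<Rightarrow> ('r, 'e, 'y) module_scheme
      \<Rightarrow> (('r, 'a \<Rightarrow> 'e) module \<Rightarrow> ('a \<Rightarrow> 'e) set) \<Rightarrow> ('r, 'a) module \<Rightarrow> 'a set"
  where "smile_dual R E \<alpha> A = dual_quot_dual R E A (\<alpha> (matlis_dual R E A))"

definition smile_dual_closure ::
    "('r, 'x) ring_scheme \<Rightarrow> ('r, 'e, 'y) module_scheme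
      \<Rightarrow> (('r, 'a \<Rightarrow> 'e) module \<Rightarrow> ('a \<Rightarrow> 'e) set \<Rightarrow> ('a \<Rightarrow> 'e) set)
      \<Rightarrow> 'a set \<Rightarrow> ('r, 'a) module \<Rightarrow> 'a set"
  where "smile_dual_closure R E cl A B =
    dual_quot_dual R E B (cl (matlis_dual R E B) (quot_dual R E B A))"

end

theory Submission
  imports Defs
begin

text \<open>
  Under the identification of a module with its bidual, the dual of a quotient \<open>M\<^sup>\<or>/D\<close> is the
  submodule of \<open>M\<close> on which all functionals in \<open>D\<close> vanish (\<open>dual_quot_dual_eq_annihilator\<close>).  So
  both sides of the theorem are annihilators.  Write \<open>Z\<close> for the closure of zero in \<open>A\<^sup>\<or>\<close> and \<open>K\<close>
  for \<open>(B/A)\<^sup>\<or>\<close>, the functionals on \<open>B\<close> that vanish on \<open>A\<close>.  The left side consists of the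
  \<open>x \<in> A\<close> that are killed by \<open>Z\<close>, the right side of the \<open>x \<in> B\<close> that are killed by the closure of
  \<open>K\<close> in \<open>B\<^sup>\<or>\<close>.

  Since \<open>E\<close> is injective, restriction \<open>B\<^sup>\<or> \<rightarrow> A\<^sup>\<or>\<close> is surjective (\<open>restrict_surj\<close>), and its kernel is
  \<open>K\<close>.  Both duals belong to the class, because the members of the class are isomorphic to their biduals
  (\<open>in_dual_class_dual\<close>).  Residuality therefore identifies the closure of \<open>K\<close> with the preimage of
  \<open>Z\<close> under restriction (\<open>residual_closure_kernel\<close>).  A functional on \<open>B\<close> has the same value at a
  point of \<open>A\<close> as its restriction, and every element of \<open>Z\<close> is a restriction, so the two sides have
  the same points in \<open>A\<close>.

  It remains to see that the right side is contained in \<open>A\<close>.  Its points are killed by \<open>K\<close>, and a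
  point of \<open>B\<close> that is killed by every functional vanishing on \<open>A\<close> lies in \<open>A\<close>.  This follows from
  the dualizability of \<open>A\<close> and \<open>B\<close> (\<open>double_annihilator\<close>).
\<close>

section \<open>Homomorphisms of modules\<close>

lemma mod_homI:
  assumes "\<And>x. x \<in> carrier M \<Longrightarrow> f x \<in> carrier N"
    and "\<And>x y. x \<in> carrier M \<Longrightarrow> y \<in> carrier M \<Longrightarrow> f (x \<oplus>\<^bsub>M\<^esub> y) = f x \<oplus>\<^bsub>N\<^esub> f y"
    and "\<And>r x. r \<in> carrier R \<Longrightarrow> x \<in> carrier M \<Longrightarrow> f (r \<odot>\<^bsub>M\<^esub> x) = r \<odot>\<^bsub>N\<^esub> f x"
  shows "f \<in> mod_hom R M N"
  using assms by (auto simp: mod_hom_def hom_def)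

lemma mod_homD:
  assumes "f \<in> mod_hom R M N"
  shows "x \<in> carrier M \<Longrightarrow> f x \<in> carrier N"
    and "x \<in> carrier M \<Longrightarrow> y \<in> carrier M \<Longrightarrow> f (x \<oplus>\<^bsub>M\<^esub> y) = f x \<oplus>\<^bsub>N\<^esub> f y"
    and "r \<in> carrier R \<Longrightarrow> x \<in> carrier M \<Longrightarrow> f (r \<odot>\<^bsub>M\<^esub> x) = r \<odot>\<^bsub>N\<^esub> f x"
  using assms by (auto simp: mod_hom_def hom_def)

lemma mod_hom_zero:
  assumes "module R M" "module R N" "f \<in> mod_hom R M N"
  shows "f \<zero>\<^bsub>M\<^esub> = \<zero>\<^bsub>N\<^esub>"
proof -
  interpret M: module R M by fact
  interpret N: module R N by fact
  show ?thesis
    using mod_homD(3)[OF assms(3), of "\<zero>\<^bsub>R\<^esub>" "\<zero>\<^bsub>M\<^esub>"] mod_homD(1)[OF assms(3), of "\<zero>\<^bsub>M\<^esub>"] by simp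
qed

lemma mod_hom_minus:
  assumes "module R M" "module R N" "f \<in> mod_hom R M N" "x \<in> carrier M"
  shows "f (\<ominus>\<^bsub>M\<^esub> x) = \<ominus>\<^bsub>N\<^esub> f x"
proof -
  interpret M: module R M by fact
  interpret N: module R N by fact
  show ?thesis
    using mod_homD(3)[OF assms(3), of "\<ominus>\<^bsub>R\<^esub> \<one>\<^bsub>R\<^esub>" x] mod_homD(1)[OF assms(3), of x] assms(4)
    by (simp add: M.smult_l_minus N.smult_l_minus)
qed

lemma mod_hom_comp:
  "f \<in> mod_hom R M N \<Longrightarrow> g \<in> mod_hom R N P \<Longrightarrow> (\<lambda>x. g (f x)) \<in> mod_hom R M P"
  by (rule mod_homI) (simp_all add: mod_homD)

lemma mod_iso_comp:
  assumes "f \<in> mod_iso R M N" "g \<in> mod_iso R N P"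
  shows "(\<lambda>x. g (f x)) \<in> mod_iso R M P"
  using assms bij_betw_trans[of f _ _ g] by (auto simp: mod_iso_def o_def intro: mod_hom_comp)

lemma mod_iso_inv_into:
  assumes "module R M" "f \<in> mod_iso R M N"
  shows "inv_into (carrier M) f \<in> mod_iso R N M"
proof -
  interpret M: module R M by fact
  have f: "f \<in> mod_hom R M N" and bij: "bij_betw f (carrier M) (carrier N)"
    using assms(2) by (auto simp: mod_iso_def)
  let ?g = "inv_into (carrier M) f"
  have g: "?g y \<in> carrier M" "f (?g y) = y" if "y \<in> carrier N" for y
    using bij that by (auto simp: bij_betw_def inv_into_into f_inv_into_f)
  have eq: "?g (f x) = x" if "x \<in> carrier M" for x
    using bij that by (simp add: bij_betw_def)
  have "?g \<in> mod_hom R N M"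
  proof (rule mod_homI)
    fix x y assume "x \<in> carrier N" "y \<in> carrier N"
    then show "?g (x \<oplus>\<^bsub>N\<^esub> y) = ?g x \<oplus>\<^bsub>M\<^esub> ?g y"
      using mod_homD(2)[OF f, of "?g x" "?g y"] eq[of "?g x \<oplus>\<^bsub>M\<^esub> ?g y"] g by simp
  next
    fix r y assume "r \<in> carrier R" "y \<in> carrier N"
    then show "?g (r \<odot>\<^bsub>N\<^esub> y) = r \<odot>\<^bsub>M\<^esub> ?g y"
      using mod_homD(3)[OF f, of r "?g y"] eq[of "r \<odot>\<^bsub>M\<^esub> ?g y"] g by simp
  qed (rule g)
  then show ?thesis using bij_betw_inv_into[OF bij] by (simp add: mod_iso_def)
qed

lemma submodule_zero: "submodule L R M \<Longrightarrow> \<zero>\<^bsub>M\<^esub> \<in> L"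
  using subgroup.one_closed[of L "add_monoid M"] submodule.axioms(1)[of L R M] by simp

lemma zero_submodule:
  assumes "module R M"
  shows "submodule {\<zero>\<^bsub>M\<^esub>} R M"
proof -
  interpret module R M by fact
  show ?thesis by (rule submoduleI) auto
qed

lemma image_submodule:
  assumes "module R M" "module R N" "f \<in> mod_hom R M N" "submodule L R M"
  shows "submodule (f ` L) R N"
proof -
  interpret M: module R M by fact
  interpret N: module R N by fact
  note L = M.submoduleE[OF assms(4)] and f = mod_homD[OF assms(3)]
  have car: "x \<in> carrier M" if "x \<in> L" for x using that L(1) by blast
  show ?thesis
  proof (rule N.submoduleI)
    show "f ` L \<subseteq> carrier N" using f(1) car by blast
    show "\<zero>\<^bsub>N\<^esub> \<in> f ` L"
      using mod_hom_zero[OF assms(1-3)] submodule_zero[OF assms(4)] by force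
    show "\<ominus>\<^bsub>N\<^esub> a \<in> f ` L" if "a \<in> f ` L" for a
      using that by (auto simp: car L(3) mod_hom_minus[OF assms(1-3), symmetric])
    show "a \<oplus>\<^bsub>N\<^esub> b \<in> f ` L" if "a \<in> f ` L" "b \<in> f ` L" for a b
      using that by (auto simp: car L(5) f(2)[symmetric])
    show "r \<odot>\<^bsub>N\<^esub> a \<in> f ` L" if "r \<in> carrier R" "a \<in> f ` L" for r a
      using that by (auto simp: car L(4) f(3)[symmetric])
  qed
qed

lemma vimage_submodule:
  assumes "module R M" "module R N" "f \<in> mod_hom R M N" "submodule K R N"
  shows "submodule {x \<in> carrier M. f x \<in> K} R M"
proof -
  interpret M: module R M by fact
  interpret N: module R N by fact
  note K = N.submoduleE[OF assms(4)] and f = mod_homD[OF assms(3)]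
  show ?thesis
    by (rule M.submoduleI)
      (use K f submodule_zero[OF assms(4)] mod_hom_zero[OF assms(1-3)] mod_hom_minus[OF assms(1-3)]
        in auto)
qed

lemma mod_hom_eq_iff:
  assumes "module R M" "module R N" "f \<in> mod_hom R M N" "x \<in> carrier M" "y \<in> carrier M"
  shows "f x = f y \<longleftrightarrow> f (x \<oplus>\<^bsub>M\<^esub> \<ominus>\<^bsub>M\<^esub> y) = \<zero>\<^bsub>N\<^esub>"
proof -
  interpret M: module R M by fact
  interpret N: module R N by fact
  have car: "f x \<in> carrier N" "f y \<in> carrier N" using assms mod_homD(1) by metis+
  have "f (x \<oplus>\<^bsub>M\<^esub> \<ominus>\<^bsub>M\<^esub> y) = f x \<oplus>\<^bsub>N\<^esub> \<ominus>\<^bsub>N\<^esub> f y"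
    using assms by (simp add: mod_homD(2)[OF assms(3)] mod_hom_minus[OF assms(1-3)])
  then show ?thesis
    using car by (metis N.M.minus_equality N.M.minus_minus N.a_inv_closed N.M.r_neg)
qed

text \<open>
  The universal property of a surjection.  It speaks of fibres and not of the kernel so that it
  applies to a projection onto cosets before these are known to form a module.
\<close>

lemma mod_hom_factor:
  assumes "module R M" "p \<in> mod_hom R M N" "p ` carrier M = carrier N" "f \<in> mod_hom R M P"
    and fib: "\<And>x y. x \<in> carrier M \<Longrightarrow> y \<in> carrier M \<Longrightarrow> p x = p y \<Longrightarrow> f x = f y"
  shows "\<exists>g\<in>mod_hom R N P \<inter> extensional (carrier N). \<forall>x\<in>carrier M. g (p x) = f x"
proof -
  interpret M: module R M by fact
  define s where "s = inv_into (carrier M) p"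
  have s: "s y \<in> carrier M" "p (s y) = y" if "y \<in> carrier N" for y
    using that assms(3) by (auto simp: s_def inv_into_into f_inv_into_f)
  let ?g = "\<lambda>y\<in>carrier N. f (s y)"
  have gp: "?g (p x) = f x" if "x \<in> carrier M" for x
    using that s[of "p x"] mod_homD(1)[OF assms(2)] by (auto intro: fib)
  have "?g \<in> mod_hom R N P"
  proof (rule mod_homI)
    show "?g y \<in> carrier P" if "y \<in> carrier N" for y
      using that s mod_homD(1)[OF assms(4)] by simp
    fix x y assume xy: "x \<in> carrier N" "y \<in> carrier N"
    have "?g (x \<oplus>\<^bsub>N\<^esub> y) = ?g (p (s x \<oplus>\<^bsub>M\<^esub> s y))"
      using xy s by (simp add: mod_homD(2)[OF assms(2)])
    also have "\<dots> = f (s x) \<oplus>\<^bsub>P\<^esub> f (s y)"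
      using xy s by (simp add: gp mod_homD(2)[OF assms(4)] del: restrict_apply)
    finally show "?g (x \<oplus>\<^bsub>N\<^esub> y) = ?g x \<oplus>\<^bsub>P\<^esub> ?g y" using xy by simp
  next
    fix r y assume ry: "r \<in> carrier R" "y \<in> carrier N"
    have "?g (r \<odot>\<^bsub>N\<^esub> y) = ?g (p (r \<odot>\<^bsub>M\<^esub> s y))"
      using ry s by (simp add: mod_homD(3)[OF assms(2)])
    also have "\<dots> = r \<odot>\<^bsub>P\<^esub> f (s y)"
      using ry s by (simp add: gp mod_homD(3)[OF assms(4)] del: restrict_apply)
    finally show "?g (r \<odot>\<^bsub>N\<^esub> y) = r \<odot>\<^bsub>P\<^esub> ?g y" using ry by simp
  qed
  then show ?thesis using gp by (intro bexI[of _ ?g]) auto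
qed


section \<open>Quotients\<close>

lemma coset_eq_iff:
  assumes "module R M" "submodule L R M" "x \<in> carrier M" "y \<in> carrier M"
  shows "L +>\<^bsub>M\<^esub> x = L +>\<^bsub>M\<^esub> y \<longleftrightarrow> x \<oplus>\<^bsub>M\<^esub> \<ominus>\<^bsub>M\<^esub> y \<in> L"
proof -
  interpret M: module R M by fact
  interpret L: abelian_subgroup L M
    using submodule.axioms(1)[OF assms(2)] M.abelian_group_axioms
    by (intro abelian_subgroupI3 additive_subgroupI)
  show ?thesis
    using L.a_rcos_module[OF assms(4,3)] L.a_rcos_self[OF assms(3)]
      L.a_repr_independence'[OF _ assms(4), of x] by auto
qed

lemma quot_projection:
  assumes "module R M" "submodule L R M"
  shows "(\<lambda>x. L +>\<^bsub>M\<^esub> x) \<in> mod_hom R M (quot_module R M L)"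
    and "(\<lambda>x. L +>\<^bsub>M\<^esub> x) ` carrier M = carrier (quot_module R M L)"
proof -
  interpret M: module R M by fact
  interpret L: abelian_subgroup L M
    using submodule.axioms(1)[OF assms(2)] M.abelian_group_axioms
    by (intro abelian_subgroupI3 additive_subgroupI)
  note subL = M.submoduleE[OF assms(2)]
  show onto: "(\<lambda>x. L +>\<^bsub>M\<^esub> x) ` carrier M = carrier (quot_module R M L)"
    by (auto simp: quot_module_def A_RCOSETS_def')
  show "(\<lambda>x. L +>\<^bsub>M\<^esub> x) \<in> mod_hom R M (quot_module R M L)"
  proof (rule mod_homI)
    show "L +>\<^bsub>M\<^esub> x \<in> carrier (quot_module R M L)" if "x \<in> carrier M" for x
      using that onto by blast
    show "L +>\<^bsub>M\<^esub> (x \<oplus>\<^bsub>M\<^esub> y) = (L +>\<^bsub>M\<^esub> x) \<oplus>\<^bsub>quot_module R M L\<^esub> (L +>\<^bsub>M\<^esub> y)"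
      if "x \<in> carrier M" "y \<in> carrier M" for x y
      using L.a_rcos_sum[OF that] by (simp add: quot_module_def)
    fix r x assume r: "r \<in> carrier R" and x: "x \<in> carrier M"
    have "L +>\<^bsub>M\<^esub> (r \<odot>\<^bsub>M\<^esub> y) = L +>\<^bsub>M\<^esub> (r \<odot>\<^bsub>M\<^esub> x)" if "y \<in> L +>\<^bsub>M\<^esub> x" for y
    proof -
      have y: "y \<in> carrier M" using that x L.a_elemrcos_carrier by blast
      have "y \<oplus>\<^bsub>M\<^esub> \<ominus>\<^bsub>M\<^esub> x \<in> L" using that x y by (simp add: L.a_rcos_module)
      then have "r \<odot>\<^bsub>M\<^esub> (y \<oplus>\<^bsub>M\<^esub> \<ominus>\<^bsub>M\<^esub> x) \<in> L" using r subL(4) by blast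
      then show ?thesis
        using r x y by (simp add: coset_eq_iff[OF assms] M.smult_r_distr M.smult_r_minus)
    qed
    then have "(\<Union>y\<in>L +>\<^bsub>M\<^esub> x. L +>\<^bsub>M\<^esub> (r \<odot>\<^bsub>M\<^esub> y)) = L +>\<^bsub>M\<^esub> (r \<odot>\<^bsub>M\<^esub> x)"
      using L.a_rcos_self[OF x] by blast
    then show "L +>\<^bsub>M\<^esub> (r \<odot>\<^bsub>M\<^esub> x) = r \<odot>\<^bsub>quot_module R M L\<^esub> (L +>\<^bsub>M\<^esub> x)"
      by (simp add: quot_module_def)
  qed
qed

text \<open>
  The homomorphism theorem.  Two points have the same coset exactly if their difference lies in the
  kernel, that is, if they have the same image; this gives both well-definedness and injectivity.
\<close>

lemma quot_iso:
  assumes "module R M" "module R N" "p \<in> mod_hom R M N" "p ` carrier M = carrier N"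
    and L: "submodule L R M" "L = {x \<in> carrier M. p x = \<zero>\<^bsub>N\<^esub>}"
  obtains t where "t \<in> mod_iso R (quot_module R M L) N"
    and "\<And>x. x \<in> carrier M \<Longrightarrow> t (L +>\<^bsub>M\<^esub> x) = p x"
proof -
  interpret M: module R M by fact
  note \<pi> = quot_projection[OF assms(1) L(1)]
  have fib: "L +>\<^bsub>M\<^esub> x = L +>\<^bsub>M\<^esub> y \<longleftrightarrow> p x = p y" if "x \<in> carrier M" "y \<in> carrier M" for x y
    unfolding coset_eq_iff[OF assms(1) L(1) that] mod_hom_eq_iff[OF assms(1-3) that]
    using that by (simp add: L(2))
  obtain t where t: "t \<in> mod_hom R (quot_module R M L) N \<inter> extensional (carrier (quot_module R M L))"
    "\<And>x. x \<in> carrier M \<Longrightarrow> t (L +>\<^bsub>M\<^esub> x) = p x"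
    using mod_hom_factor[OF assms(1) \<pi> assms(3)] fib by blast
  have "bij_betw t (carrier (quot_module R M L)) (carrier N)"
    unfolding bij_betw_def \<pi>(2)[symmetric] image_image
    using fib t(2) assms(4) by (auto simp: inj_on_def)
  then show thesis using t by (intro that[of t]) (simp_all add: mod_iso_def)
qed


section \<open>Matlis duals\<close>

lemma matlis_dual_sel:
  "carrier (matlis_dual R E M) = mod_hom R M E \<inter> extensional (carrier M)"
  "f \<oplus>\<^bsub>matlis_dual R E M\<^esub> g = (\<lambda>x\<in>carrier M. f x \<oplus>\<^bsub>E\<^esub> g x)"
  "r \<odot>\<^bsub>matlis_dual R E M\<^esub> f = (\<lambda>x\<in>carrier M. r \<odot>\<^bsub>E\<^esub> f x)"
  "\<zero>\<^bsub>matlis_dual R E M\<^esub> = (\<lambda>x\<in>carrier M. \<zero>\<^bsub>E\<^esub>)"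
  by (simp_all add: matlis_dual_def Hom_module_def)

lemma matlis_dual_eqI:
  assumes "f \<in> carrier (matlis_dual R E M)" "g \<in> carrier (matlis_dual R E M)"
    and "\<And>x. x \<in> carrier M \<Longrightarrow> f x = g x"
  shows "f = g"
  using assms by (auto simp: matlis_dual_sel intro: extensionalityI)

lemma matlis_dual_module:
  assumes "module R E" "module R M"
  shows "module R (matlis_dual R E M)"
proof -
  interpret E: module R E by fact
  interpret M: module R M by fact
  have add: "f \<oplus>\<^bsub>matlis_dual R E M\<^esub> g \<in> carrier (matlis_dual R E M)"
    if "f \<in> carrier (matlis_dual R E M)" "g \<in> carrier (matlis_dual R E M)" for f g
  proof -
    have fg: "f \<in> mod_hom R M E" "g \<in> mod_hom R M E" using that by (simp_all add: matlis_dual_sel)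
    have "(\<lambda>x\<in>carrier M. f x \<oplus>\<^bsub>E\<^esub> g x) \<in> mod_hom R M E"
      by (rule mod_homI)
        (simp_all add: mod_homD[OF fg(1)] mod_homD[OF fg(2)] E.M.a_ac E.smult_r_distr)
    then show ?thesis by (simp add: matlis_dual_sel)
  qed
  have smult: "r \<odot>\<^bsub>matlis_dual R E M\<^esub> f \<in> carrier (matlis_dual R E M)"
    if "r \<in> carrier R" "f \<in> carrier (matlis_dual R E M)" for r f
  proof -
    have f: "f \<in> mod_hom R M E" using that by (simp add: matlis_dual_sel)
    have "r \<odot>\<^bsub>E\<^esub> (s \<odot>\<^bsub>E\<^esub> f x) = s \<odot>\<^bsub>E\<^esub> (r \<odot>\<^bsub>E\<^esub> f x)" if "s \<in> carrier R" "x \<in> carrier M" for s x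
      using that \<open>r \<in> carrier R\<close> mod_homD(1)[OF f]
      by (simp add: E.smult_assoc1[symmetric] E.R.m_comm)
    then have "(\<lambda>x\<in>carrier M. r \<odot>\<^bsub>E\<^esub> f x) \<in> mod_hom R M E"
      using that(1) by (intro mod_homI) (simp_all add: mod_homD[OF f] E.smult_r_distr)
    then show ?thesis by (simp add: matlis_dual_sel)
  qed
  have zero: "\<zero>\<^bsub>matlis_dual R E M\<^esub> \<in> carrier (matlis_dual R E M)"
    by (auto simp: matlis_dual_sel intro!: mod_homI)
  have app: "f x \<in> carrier E" if "f \<in> carrier (matlis_dual R E M)" "x \<in> carrier M" for f x
    using that by (auto simp: matlis_dual_sel dest: mod_homD(1))
  have "abelian_group (matlis_dual R E M)"
  proof (rule abelian_groupI)
    fix f assume f: "f \<in> carrier (matlis_dual R E M)"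
    have "(\<ominus>\<^bsub>R\<^esub> \<one>\<^bsub>R\<^esub>) \<odot>\<^bsub>matlis_dual R E M\<^esub> f \<oplus>\<^bsub>matlis_dual R E M\<^esub> f = \<zero>\<^bsub>matlis_dual R E M\<^esub>"
      by (rule matlis_dual_eqI[OF add[OF smult[OF _ f] f] zero])
        (use app[OF f] in \<open>simp_all add: matlis_dual_sel E.smult_l_minus E.M.l_neg\<close>)
    then show "\<exists>g\<in>carrier (matlis_dual R E M). g \<oplus>\<^bsub>matlis_dual R E M\<^esub> f = \<zero>\<^bsub>matlis_dual R E M\<^esub>"
      using smult[OF _ f] by (meson E.R.add.inv_closed E.R.one_closed)
    show "\<zero>\<^bsub>matlis_dual R E M\<^esub> \<oplus>\<^bsub>matlis_dual R E M\<^esub> f = f"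
      by (rule matlis_dual_eqI[OF add[OF zero f] f]) (use app[OF f] in \<open>simp add: matlis_dual_sel\<close>)
    fix g assume g: "g \<in> carrier (matlis_dual R E M)"
    show "f \<oplus>\<^bsub>matlis_dual R E M\<^esub> g = g \<oplus>\<^bsub>matlis_dual R E M\<^esub> f"
      by (rule matlis_dual_eqI[OF add[OF f g] add[OF g f]])
        (use app f g in \<open>simp add: matlis_dual_sel(2) E.M.a_comm\<close>)
    fix h assume h: "h \<in> carrier (matlis_dual R E M)"
    show "f \<oplus>\<^bsub>matlis_dual R E M\<^esub> g \<oplus>\<^bsub>matlis_dual R E M\<^esub> h = f \<oplus>\<^bsub>matlis_dual R E M\<^esub> (g \<oplus>\<^bsub>matlis_dual R E M\<^esub> h)"
      by (rule matlis_dual_eqI[OF add[OF add[OF f g] h] add[OF f add[OF g h]]])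
        (use app f g h in \<open>simp add: matlis_dual_sel(2) E.M.a_assoc\<close>)
  qed (rule add zero; assumption)+
  then show ?thesis
  proof (intro moduleI E.R.cring_axioms smult)
    fix r s f assume rs: "r \<in> carrier R" "s \<in> carrier R" and f: "f \<in> carrier (matlis_dual R E M)"
    show "(r \<oplus>\<^bsub>R\<^esub> s) \<odot>\<^bsub>matlis_dual R E M\<^esub> f = r \<odot>\<^bsub>matlis_dual R E M\<^esub> f \<oplus>\<^bsub>matlis_dual R E M\<^esub> s \<odot>\<^bsub>matlis_dual R E M\<^esub> f"
      using rs app[OF f] by (auto simp: matlis_dual_sel(2,3) E.smult_l_distr intro!: restrict_ext)
    show "(r \<otimes>\<^bsub>R\<^esub> s) \<odot>\<^bsub>matlis_dual R E M\<^esub> f = r \<odot>\<^bsub>matlis_dual R E M\<^esub> (s \<odot>\<^bsub>matlis_dual R E M\<^esub> f)"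
      using rs app[OF f] by (auto simp: matlis_dual_sel(3) E.smult_assoc1 intro!: restrict_ext)
  next
    fix r f g assume r: "r \<in> carrier R"
      and f: "f \<in> carrier (matlis_dual R E M)" and g: "g \<in> carrier (matlis_dual R E M)"
    show "r \<odot>\<^bsub>matlis_dual R E M\<^esub> (f \<oplus>\<^bsub>matlis_dual R E M\<^esub> g) = r \<odot>\<^bsub>matlis_dual R E M\<^esub> f \<oplus>\<^bsub>matlis_dual R E M\<^esub> r \<odot>\<^bsub>matlis_dual R E M\<^esub> g"
      using r app[OF f] app[OF g] by (auto simp: matlis_dual_sel(2,3) E.smult_r_distr intro!: restrict_ext)
  next
    fix f assume f: "f \<in> carrier (matlis_dual R E M)"
    show "\<one>\<^bsub>R\<^esub> \<odot>\<^bsub>matlis_dual R E M\<^esub> f = f"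
      by (rule matlis_dual_eqI[OF smult[OF _ f] f]) (simp_all add: matlis_dual_sel(3) app[OF f])
  qed
qed

definition dual_map :: "('r, 'm, 'y) module_scheme \<Rightarrow> ('m \<Rightarrow> 'n) \<Rightarrow> ('n \<Rightarrow> 'e) \<Rightarrow> 'm \<Rightarrow> 'e"
  where "dual_map M h f = (\<lambda>x\<in>carrier M. f (h x))"

lemma dual_map_hom:
  assumes "module R M" "h \<in> mod_hom R M N"
  shows "dual_map M h \<in> mod_hom R (matlis_dual R E N) (matlis_dual R E M)"
proof -
  interpret M: module R M by fact
  show ?thesis
  proof (rule mod_homI)
    fix f assume "f \<in> carrier (matlis_dual R E N)"
    then have f: "f \<in> mod_hom R N E" by (simp add: matlis_dual_sel)
    have "(\<lambda>x\<in>carrier M. f (h x)) \<in> mod_hom R M E"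
      by (rule mod_homI) (simp_all add: mod_homD[OF f] mod_homD[OF assms(2)])
    then show "dual_map M h f \<in> carrier (matlis_dual R E M)"
      by (simp add: matlis_dual_sel dual_map_def)
  qed (auto simp: matlis_dual_sel dual_map_def mod_homD[OF assms(2)])
qed

lemma dual_map_iso:
  assumes "module R M" "module R N" "h \<in> mod_iso R M N"
  shows "dual_map M h \<in> mod_iso R (matlis_dual R E N) (matlis_dual R E M)"
proof -
  let ?k = "inv_into (carrier M) h"
  have h: "h \<in> mod_hom R M N" and bij: "bij_betw h (carrier M) (carrier N)"
    using assms(3) by (auto simp: mod_iso_def)
  have k: "?k \<in> mod_hom R N M"
    using mod_iso_inv_into[OF assms(1,3)] by (simp add: mod_iso_def)
  have kh: "?k (h x) = x" if "x \<in> carrier M" for x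
    using that bij by (simp add: bij_betw_def)
  have hk: "h (?k y) = y" if "y \<in> carrier N" for y
    using that bij by (simp add: bij_betw_def f_inv_into_f)
  note dh = dual_map_hom[OF assms(1) h, of E] and dk = dual_map_hom[OF assms(2) k, of E]
  have "bij_betw (dual_map M h) (carrier (matlis_dual R E N)) (carrier (matlis_dual R E M))"
  proof (rule bij_betw_byWitness[where f' = "dual_map N ?k"])
    show "\<forall>f\<in>carrier (matlis_dual R E N). dual_map N ?k (dual_map M h f) = f"
    proof
      fix f assume f: "f \<in> carrier (matlis_dual R E N)"
      show "dual_map N ?k (dual_map M h f) = f"
        by (rule matlis_dual_eqI[OF mod_homD(1)[OF dk mod_homD(1)[OF dh f]] f])
          (simp add: dual_map_def hk mod_homD(1)[OF k])
    qed
    show "\<forall>f\<in>carrier (matlis_dual R E M). dual_map M h (dual_map N ?k f) = f"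
    proof
      fix f assume f: "f \<in> carrier (matlis_dual R E M)"
      show "dual_map M h (dual_map N ?k f) = f"
        by (rule matlis_dual_eqI[OF mod_homD(1)[OF dh mod_homD(1)[OF dk f]] f])
          (simp add: dual_map_def kh mod_homD(1)[OF h])
    qed
  qed (use mod_homD(1)[OF dh] mod_homD(1)[OF dk] in auto)
  then show ?thesis using dh by (simp add: mod_iso_def)
qed

lemma restrict_hom:
  assumes "module R B" "submodule A R B"
  shows "(\<lambda>f. restrict f A) \<in> mod_hom R (matlis_dual R E B) (matlis_dual R E (B\<lparr>carrier := A\<rparr>))"
proof -
  interpret B: module R B by fact
  have A: "A \<subseteq> carrier B" using B.submoduleE(1)[OF assms(2)] .
  then have "(\<lambda>x. x) \<in> mod_hom R (B\<lparr>carrier := A\<rparr>) B" by (intro mod_homI) auto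
  from dual_map_hom[OF submodule.submodule_is_module[OF assms(2,1)] this, of E]
  show ?thesis by (simp add: dual_map_def[abs_def])
qed

text \<open>Dualizing into an injective module turns the inclusion of \<open>A\<close> into a surjection.\<close>

lemma restrict_surj:
  fixes B :: "('r, 'm) module"
  assumes "injective_module TYPE('r) R E" "module R B" "submodule A R B"
  shows "(\<lambda>f. restrict f A) ` carrier (matlis_dual R E B) = carrier (matlis_dual R E (B\<lparr>carrier := A\<rparr>))"
proof (intro equalityI subsetI)
  interpret B: module R B by fact
  have A: "A \<subseteq> carrier B" using B.submoduleE(1)[OF assms(3)] .
  fix g assume g: "g \<in> carrier (matlis_dual R E (B\<lparr>carrier := A\<rparr>))"
  then have "g \<in> mod_hom R (B\<lparr>carrier := A\<rparr>) E" by (simp add: matlis_dual_sel)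
  then obtain h where h: "h \<in> mod_hom R B E" "\<And>x. x \<in> A \<Longrightarrow> h x = g x"
    using injective_module_all_types[OF assms(1), where ?'n = 'm] assms(2,3)
    unfolding injective_module_def by blast
  have "restrict h (carrier B) \<in> carrier (matlis_dual R E B)"
    using h(1) by (auto simp: matlis_dual_sel mod_homD intro!: mod_homI)
  moreover have "restrict (restrict h (carrier B)) A = g"
    using g h(2) A by (auto simp: matlis_dual_sel fun_eq_iff restrict_def extensional_def)
  ultimately show "g \<in> (\<lambda>f. restrict f A) ` carrier (matlis_dual R E B)" by blast
qed (use mod_homD(1)[OF restrict_hom[OF assms(2,3)]] in auto)

text \<open>
  By the universal property of the quotient, the dual of \<open>M/L\<close> is the annihilator of \<open>L\<close> in the
  dual of \<open>M\<close>.
\<close>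

lemma quot_dual_eq_annihilator:
  assumes "module R E" "module R M" "submodule L R M"
  shows "quot_dual R E M L = {f \<in> carrier (matlis_dual R E M). \<forall>x\<in>L. f x = \<zero>\<^bsub>E\<^esub>}"
proof (intro equalityI subsetI)
  interpret M: module R M by fact
  note \<pi> = quot_projection[OF assms(2,3)]
  have L: "L \<subseteq> carrier M" using M.submoduleE(1)[OF assms(3)] .
  note coset = coset_eq_iff[OF assms(2,3)]
  {
    fix f assume "f \<in> quot_dual R E M L"
    then obtain g where g: "g \<in> carrier (matlis_dual R E (quot_module R M L))"
      and f: "f = dual_map M (\<lambda>x. L +>\<^bsub>M\<^esub> x) g"
      by (auto simp: quot_dual_def dual_map_def)
    have fd: "f \<in> carrier (matlis_dual R E M)"
      using mod_homD(1)[OF dual_map_hom[OF assms(2) \<pi>(1)] g] f by simp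
    have "f x = \<zero>\<^bsub>E\<^esub>" if "x \<in> L" for x
    proof -
      have "L +>\<^bsub>M\<^esub> x = L +>\<^bsub>M\<^esub> \<zero>\<^bsub>M\<^esub>"
        using that L M.a_coset_join2[of _ L] submodule.axioms(1)[OF assms(3)] by (simp add: subset_iff)
      then have "f x = f \<zero>\<^bsub>M\<^esub>" using that L by (auto simp: f dual_map_def)
      then show ?thesis
        using mod_hom_zero[OF assms(2,1), of f] fd by (simp add: matlis_dual_sel)
    qed
    then show "f \<in> {f \<in> carrier (matlis_dual R E M). \<forall>x\<in>L. f x = \<zero>\<^bsub>E\<^esub>}" using fd by simp
  next
    fix f assume "f \<in> {f \<in> carrier (matlis_dual R E M). \<forall>x\<in>L. f x = \<zero>\<^bsub>E\<^esub>}"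
    then have f: "f \<in> mod_hom R M E" "f \<in> extensional (carrier M)" "\<And>x. x \<in> L \<Longrightarrow> f x = \<zero>\<^bsub>E\<^esub>"
      by (auto simp: matlis_dual_sel)
    have "f x = f y" if "x \<in> carrier M" "y \<in> carrier M" "L +>\<^bsub>M\<^esub> x = L +>\<^bsub>M\<^esub> y" for x y
      using that f(3) coset mod_hom_eq_iff[OF assms(2,1) f(1)] by metis
    then obtain g where g: "g \<in> mod_hom R (quot_module R M L) E \<inter> extensional (carrier (quot_module R M L))"
      "\<And>x. x \<in> carrier M \<Longrightarrow> g (L +>\<^bsub>M\<^esub> x) = f x"
      using mod_hom_factor[OF assms(2) \<pi> f(1)] by blast
    have "f = (\<lambda>x\<in>carrier M. g (L +>\<^bsub>M\<^esub> x))"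
      using f(2) g(2) by (auto intro: extensionalityI)
    then show "f \<in> quot_dual R E M L"
      using g(1) by (auto simp: quot_dual_def matlis_dual_sel)
  }
qed

lemma bidual_map_hom:
  assumes "module R E" "module R M"
  shows "bidual_map R E M \<in> mod_hom R M (matlis_dual R E (matlis_dual R E M))"
proof -
  interpret M: module R M by fact
  interpret D: module R "matlis_dual R E M" by (rule matlis_dual_module[OF assms])
  have hom: "f \<in> mod_hom R M E" if "f \<in> carrier (matlis_dual R E M)" for f
    using that by (simp add: matlis_dual_sel)
  show ?thesis
  proof (rule mod_homI)
    fix x assume x: "x \<in> carrier M"
    have "bidual_map R E M x \<in> mod_hom R (matlis_dual R E M) E"
    proof (rule mod_homI)
      fix f g assume fg: "f \<in> carrier (matlis_dual R E M)" "g \<in> carrier (matlis_dual R E M)"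
      then show "bidual_map R E M x (f \<oplus>\<^bsub>matlis_dual R E M\<^esub> g) = bidual_map R E M x f \<oplus>\<^bsub>E\<^esub> bidual_map R E M x g"
        using D.M.a_closed[OF fg] x by (simp add: bidual_map_def) (simp add: matlis_dual_sel(2))
    next
      fix r f assume rf: "r \<in> carrier R" "f \<in> carrier (matlis_dual R E M)"
      then show "bidual_map R E M x (r \<odot>\<^bsub>matlis_dual R E M\<^esub> f) = r \<odot>\<^bsub>E\<^esub> bidual_map R E M x f"
        using D.smult_closed[OF rf] x by (simp add: bidual_map_def) (simp add: matlis_dual_sel(3))
    qed (use x mod_homD(1)[OF hom] in \<open>simp add: bidual_map_def\<close>)
    then show "bidual_map R E M x \<in> carrier (matlis_dual R E (matlis_dual R E M))"
      by (simp add: matlis_dual_sel(1)[of _ _ "matlis_dual R E M"] bidual_map_def)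
  next
    fix x y assume xy: "x \<in> carrier M" "y \<in> carrier M"
    show "bidual_map R E M (x \<oplus>\<^bsub>M\<^esub> y) =
        bidual_map R E M x \<oplus>\<^bsub>matlis_dual R E (matlis_dual R E M)\<^esub> bidual_map R E M y"
      unfolding matlis_dual_sel(2) bidual_map_def
      by (rule restrict_ext) (simp add: mod_homD(2)[OF hom] xy)
  next
    fix r x assume rx: "r \<in> carrier R" "x \<in> carrier M"
    show "bidual_map R E M (r \<odot>\<^bsub>M\<^esub> x) = r \<odot>\<^bsub>matlis_dual R E (matlis_dual R E M)\<^esub> bidual_map R E M x"
      unfolding matlis_dual_sel(3) bidual_map_def
      by (rule restrict_ext) (simp add: mod_homD(3)[OF hom] rx)
  qed
qed

text \<open>
  So the submodule of \<open>M\<close> that corresponds to a submodule \<open>D\<close> of its dual is the annihilator of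
  \<open>D\<close> under evaluation.
\<close>

lemma dual_quot_dual_eq_annihilator:
  assumes "module R E" "module R M" "submodule D R (matlis_dual R E M)"
  shows "dual_quot_dual R E M D = {x \<in> carrier M. \<forall>f\<in>D. f x = \<zero>\<^bsub>E\<^esub>}"
proof -
  interpret D: module R "matlis_dual R E M" by (rule matlis_dual_module[OF assms(1,2)])
  have "D \<subseteq> carrier (matlis_dual R E M)" using D.submoduleE(1)[OF assms(3)] .
  then show ?thesis
    using mod_homD(1)[OF bidual_map_hom[OF assms(1,2)]]
    unfolding dual_quot_dual_def quot_dual_eq_annihilator[OF assms(1) D.module_axioms assms(3)]
    by (auto simp: bidual_map_def subset_iff)
qed

text \<open>
  Elementwise form of dualizability, in which transport along isomorphisms and passage to duals
  are short computations.
\<close>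

lemma matlis_dualizable_iff:
  assumes "module R E" "module R M"
  shows "matlis_dualizable R E M \<longleftrightarrow>
    (\<forall>x\<in>carrier M. \<forall>y\<in>carrier M. (\<forall>f\<in>carrier (matlis_dual R E M). f x = f y) \<longrightarrow> x = y) \<and>
    (\<forall>\<psi>\<in>carrier (matlis_dual R E (matlis_dual R E M)).
      \<exists>x\<in>carrier M. \<forall>f\<in>carrier (matlis_dual R E M). \<psi> f = f x)"
proof -
  note b = bidual_map_hom[OF assms]
  have eq: "bidual_map R E M x = \<psi> \<longleftrightarrow> (\<forall>f\<in>carrier (matlis_dual R E M). f x = \<psi> f)"
    if "\<psi> \<in> extensional (carrier (matlis_dual R E M))" for x \<psi>
    using that by (auto simp: bidual_map_def fun_eq_iff restrict_def extensional_def)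
  have eq': "bidual_map R E M x = bidual_map R E M y \<longleftrightarrow> (\<forall>f\<in>carrier (matlis_dual R E M). f x = f y)"
    for x y by (auto simp: bidual_map_def fun_eq_iff restrict_def)
  have ext: "\<psi> \<in> extensional (carrier (matlis_dual R E M))"
    if "\<psi> \<in> carrier (matlis_dual R E (matlis_dual R E M))" for \<psi>
    using that by (simp add: matlis_dual_sel(1)[of R E "matlis_dual R E M"])
  have sub: "bidual_map R E M ` carrier M \<subseteq> carrier (matlis_dual R E (matlis_dual R E M))"
    using mod_homD(1)[OF b] by (rule image_subsetI)
  have "(\<exists>x\<in>carrier M. bidual_map R E M x = \<psi>) \<longleftrightarrow>
      (\<exists>x\<in>carrier M. \<forall>f\<in>carrier (matlis_dual R E M). \<psi> f = f x)"
    if "\<psi> \<in> carrier (matlis_dual R E (matlis_dual R E M))" for \<psi>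
    unfolding eq[OF ext[OF that]] by (simp only: eq_commute)
  moreover have "bidual_map R E M ` carrier M = carrier (matlis_dual R E (matlis_dual R E M)) \<longleftrightarrow>
      (\<forall>\<psi>\<in>carrier (matlis_dual R E (matlis_dual R E M)). \<exists>x\<in>carrier M. bidual_map R E M x = \<psi>)"
  proof
    assume "\<forall>\<psi>\<in>carrier (matlis_dual R E (matlis_dual R E M)). \<exists>x\<in>carrier M. bidual_map R E M x = \<psi>"
    then have "carrier (matlis_dual R E (matlis_dual R E M)) \<subseteq> bidual_map R E M ` carrier M"
      by (intro subsetI) (metis imageI)
    with sub show "bidual_map R E M ` carrier M = carrier (matlis_dual R E (matlis_dual R E M))" ..
  qed (metis imageE)
  ultimately show ?thesis
    using b by (simp add: matlis_dualizable_def mod_iso_def bij_betw_def inj_on_def eq')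
qed

text \<open>
  A functional \<open>\<psi>\<close> on the bidual of \<open>M\<close> pulls back along \<open>M \<rightarrow> M\<^sup>\<or>\<^sup>\<or>\<close> to a functional \<open>f\<close> on \<open>M\<close>.
  Since every element of the bidual is evaluation at a point of \<open>M\<close>, \<open>\<psi>\<close> is evaluation at \<open>f\<close>.
\<close>

lemma matlis_dualizable_dual:
  assumes "module R E" "module R M" "matlis_dualizable R E M"
  shows "matlis_dualizable R E (matlis_dual R E M)"
proof -
  let ?D = "matlis_dual R E M"
  have D: "module R ?D" by (rule matlis_dual_module[OF assms(1,2)])
  note b = bidual_map_hom[OF assms(1,2)]
  have onto: "bidual_map R E M ` carrier M = carrier (matlis_dual R E ?D)"
    using assms(3) by (simp add: matlis_dualizable_def mod_iso_def bij_betw_def)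
  show ?thesis
    unfolding matlis_dualizable_iff[OF assms(1) D]
  proof (intro conjI ballI impI)
    fix f g assume f: "f \<in> carrier ?D" and g: "g \<in> carrier ?D"
      and eq: "\<forall>\<psi>\<in>carrier (matlis_dual R E ?D). \<psi> f = \<psi> g"
    show "f = g"
    proof (rule matlis_dual_eqI[OF f g])
      fix x assume "x \<in> carrier M"
      then have "bidual_map R E M x f = bidual_map R E M x g" using eq mod_homD(1)[OF b] by blast
      then show "f x = g x" using f g by (simp add: bidual_map_def)
    qed
  next
    fix \<psi> assume \<psi>: "\<psi> \<in> carrier (matlis_dual R E (matlis_dual R E ?D))"
    let ?f = "dual_map M (bidual_map R E M) \<psi>"
    have f: "?f \<in> carrier ?D" using mod_homD(1)[OF dual_map_hom[OF assms(2) b] \<psi>] .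
    have "\<psi> \<chi> = \<chi> ?f" if \<chi>: "\<chi> \<in> carrier (matlis_dual R E ?D)" for \<chi>
    proof -
      from \<chi>[folded onto] obtain x where x: "x \<in> carrier M" "\<chi> = bidual_map R E M x"
        by (rule imageE)
      have "\<chi> ?f = ?f x" using f unfolding x(2) bidual_map_def by simp
      also have "\<dots> = \<psi> \<chi>" using x by (simp add: dual_map_def)
      finally show ?thesis by simp
    qed
    then show "\<exists>f\<in>carrier ?D. \<forall>\<chi>\<in>carrier (matlis_dual R E ?D). \<psi> \<chi> = \<chi> f" using f by blast
  qed
qed

lemma matlis_dualizable_iso:
  assumes "module R E" "module R N" "module R M" "\<phi> \<in> mod_iso R N M" "matlis_dualizable R E M"
  shows "matlis_dualizable R E N"
  unfolding matlis_dualizable_iff[OF assms(1,2)]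
proof (intro conjI ballI impI)
  have bij: "bij_betw \<phi> (carrier N) (carrier M)" and \<phi>: "\<phi> \<in> mod_hom R N M"
    using assms(4) by (auto simp: mod_iso_def)
  have d: "dual_map N \<phi> \<in> mod_hom R (matlis_dual R E M) (matlis_dual R E N)"
    and onto: "dual_map N \<phi> ` carrier (matlis_dual R E M) = carrier (matlis_dual R E N)"
    using dual_map_iso[OF assms(2-4), of E] by (auto simp: mod_iso_def bij_betw_def)
  note M = assms(5)[unfolded matlis_dualizable_iff[OF assms(1,3)]]
  {
    fix x y assume xy: "x \<in> carrier N" "y \<in> carrier N"
      and eq: "\<forall>f\<in>carrier (matlis_dual R E N). f x = f y"
    have "g (\<phi> x) = g (\<phi> y)" if "g \<in> carrier (matlis_dual R E M)" for g
      using bspec[OF eq mod_homD(1)[OF d that]] xy by (simp add: dual_map_def)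
    then have "\<phi> x = \<phi> y" using M xy mod_homD(1)[OF \<phi>] by blast
    then show "x = y" using xy bij by (auto simp: bij_betw_def dest: inj_onD)
  next
    fix \<psi> assume "\<psi> \<in> carrier (matlis_dual R E (matlis_dual R E N))"
    then have "dual_map (matlis_dual R E M) (dual_map N \<phi>) \<psi> \<in> carrier (matlis_dual R E (matlis_dual R E M))"
      using mod_homD(1)[OF dual_map_hom[OF matlis_dual_module[OF assms(1,3)] d]] by blast
    then obtain m where m: "m \<in> carrier M"
      "\<And>g. g \<in> carrier (matlis_dual R E M) \<Longrightarrow> dual_map (matlis_dual R E M) (dual_map N \<phi>) \<psi> g = g m"
      using M by blast
    obtain n where n: "n \<in> carrier N" "m = \<phi> n" using bij m(1) by (auto simp: bij_betw_def)
    have "\<psi> f = f n" if f: "f \<in> carrier (matlis_dual R E N)" for f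
    proof -
      from f[folded onto] obtain g where g: "g \<in> carrier (matlis_dual R E M)" "f = dual_map N \<phi> g"
        by (rule imageE)
      then show ?thesis using m(2)[OF g(1)] n by (simp add: dual_map_def)
    qed
    then show "\<exists>x\<in>carrier N. \<forall>f\<in>carrier (matlis_dual R E N). \<psi> f = f x" using n(1) by blast
  }
qed

lemma in_dual_class_dualizable:
  assumes "module R E" "\<forall>M\<in>\<M>. module R M" "\<forall>M\<in>\<M>. matlis_dualizable R E M" "in_dual_class R E \<M> A"
  shows "matlis_dualizable R E A"
proof -
  obtain M \<phi> where "module R A" and M: "M \<in> \<M>" and "\<phi> \<in> mod_iso R A (matlis_dual R E M)"
    using assms(4) by (auto simp: in_dual_class_def)
  then show ?thesis
    using assms(1-3)
    using matlis_dualizable_iso[OF assms(1) _ matlis_dual_module[OF assms(1)], of A M \<phi>]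
      matlis_dualizable_dual[OF assms(1), of M] by blast
qed

text \<open>
  If \<open>A\<close> is isomorphic to the dual of \<open>M\<close>, then its dual is isomorphic to the bidual of \<open>M\<close>, that
  is, to \<open>M\<close>; so the dual of a member of the dual class is back in the class.
\<close>

lemma in_dual_class_dual:
  assumes "module R E" "\<forall>M\<in>\<M>. module R M" "\<forall>M\<in>\<M>. matlis_dualizable R E M" "in_dual_class R E \<M> A"
  shows "in_class R \<M> (matlis_dual R E A)"
proof -
  obtain M \<phi> where A: "module R A" and M: "M \<in> \<M>" and \<phi>: "\<phi> \<in> mod_iso R A (matlis_dual R E M)"
    using assms(4) by (auto simp: in_dual_class_def)
  have modM: "module R M" using assms(2) M by blast
  have "dual_map A \<phi> \<in> mod_iso R (matlis_dual R E (matlis_dual R E M)) (matlis_dual R E A)"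
    by (rule dual_map_iso[OF A matlis_dual_module[OF assms(1) modM] \<phi>])
  moreover have "bidual_map R E M \<in> mod_iso R M (matlis_dual R E (matlis_dual R E M))"
    using assms(3) M by (simp add: matlis_dualizable_def)
  ultimately have "(\<lambda>x. dual_map A \<phi> (bidual_map R E M x)) \<in> mod_iso R M (matlis_dual R E A)"
    using mod_iso_comp by blast
  from mod_iso_inv_into[OF modM this] show ?thesis
    using M matlis_dual_module[OF assms(1) A] by (auto simp: in_class_def)
qed

text \<open>
  A submodule is recovered from its annihilator.  If \<open>x\<close> is killed by all functionals on \<open>B\<close> that
  vanish on \<open>A\<close>, then evaluation at \<open>x\<close> depends only on the restriction to \<open>A\<close>.  As every functional
  on \<open>A\<close> is such a restriction, evaluation at \<open>x\<close> is an element of the bidual of \<open>A\<close>, hence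
  evaluation at some \<open>a \<in> A\<close>; and functionals on \<open>B\<close> separate \<open>a\<close> from \<open>x\<close> unless they are equal.
\<close>

lemma double_annihilator:
  fixes B :: "('r, 'm) module"
  assumes inj: "injective_module TYPE('r) R E" and B: "module R B" and A: "submodule A R B"
    and reflB: "matlis_dualizable R E B" and reflA: "matlis_dualizable R E (B\<lparr>carrier := A\<rparr>)"
    and x: "x \<in> carrier B"
    and kill: "\<And>f. f \<in> carrier (matlis_dual R E B) \<Longrightarrow> (\<And>a. a \<in> A \<Longrightarrow> f a = \<zero>\<^bsub>E\<^esub>) \<Longrightarrow> f x = \<zero>\<^bsub>E\<^esub>"
  shows "x \<in> A"
proof -
  interpret B: module R B by (rule B)
  have E: "module R E" using inj unfolding injective_module_def by (rule conjunct1)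
  let ?A = "B\<lparr>carrier := A\<rparr>"
  let ?DA = "matlis_dual R E ?A" and ?DB = "matlis_dual R E B"
  have modA: "module R ?A" by (rule submodule.submodule_is_module[OF A B])
  have sub: "A \<subseteq> carrier B" by (rule B.submoduleE(1)[OF A])
  interpret DB: module R ?DB by (rule matlis_dual_module[OF E B])
  have DA: "module R ?DA" by (rule matlis_dual_module[OF E modA])
  note res = restrict_hom[OF B A, of E] and onto = restrict_surj[OF inj B A]
  have ev: "bidual_map R E B x \<in> mod_hom R ?DB E"
    using mod_homD(1)[OF bidual_map_hom[OF E B] x] by (simp add: matlis_dual_sel(1)[where M = ?DB])
  have "bidual_map R E B x f = bidual_map R E B x g"
    if f: "f \<in> carrier ?DB" and g: "g \<in> carrier ?DB" and eq: "restrict f A = restrict g A" for f g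
  proof -
    \<comment> \<open>The difference of \<open>f\<close> and \<open>g\<close> vanishes on \<open>A\<close>, hence at \<open>x\<close>.\<close>
    let ?h = "f \<oplus>\<^bsub>?DB\<^esub> \<ominus>\<^bsub>?DB\<^esub> g"
    have h: "?h \<in> carrier ?DB" using f g by simp
    have rh: "restrict ?h A = \<zero>\<^bsub>?DA\<^esub>"
      using mod_hom_eq_iff[OF DB.module_axioms DA res f g] eq by simp
    have "?h a = \<zero>\<^bsub>E\<^esub>" if "a \<in> A" for a
      using that fun_cong[OF rh, of a] by (simp add: matlis_dual_sel(4))
    then have "bidual_map R E B x ?h = \<zero>\<^bsub>E\<^esub>" using kill[OF h] h by (simp add: bidual_map_def)
    then show ?thesis using mod_hom_eq_iff[OF DB.module_axioms E ev f g] by simp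
  qed
  then obtain \<psi> where \<psi>: "\<psi> \<in> mod_hom R ?DA E \<inter> extensional (carrier ?DA)"
    "\<And>f. f \<in> carrier ?DB \<Longrightarrow> \<psi> (restrict f A) = bidual_map R E B x f"
    using mod_hom_factor[OF DB.module_axioms res onto ev] by blast
  then have "\<psi> \<in> carrier (matlis_dual R E ?DA)" by (simp add: matlis_dual_sel(1)[where M = ?DA])
  then obtain a where a: "a \<in> A" "\<And>g. g \<in> carrier ?DA \<Longrightarrow> \<psi> g = g a"
    using reflA[unfolded matlis_dualizable_iff[OF E modA]] by auto
  have "f x = f a" if f: "f \<in> carrier ?DB" for f
    using \<psi>(2)[OF f] a(2)[OF mod_homD(1)[OF res f]] a(1) f by (simp add: bidual_map_def)
  then have "x = a"
    using reflB[unfolded matlis_dualizable_iff[OF E B]] x a(1) sub by blast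
  then show ?thesis using a(1) by simp
qed


section \<open>Closures in modules isomorphic to a member of the class\<close>

text \<open>
  A closure in \<open>N\<close> can be computed along any single isomorphism to a member of the class: two such
  isomorphisms differ by an isomorphism between members, and \<open>cl\<close> is compatible with those.
\<close>

lemma closure_in_iff:
  assumes cl: "closure_operation R \<M> cl" and mods: "\<forall>M\<in>\<M>. module R M"
    and N: "module R N" and M: "M \<in> \<M>" and \<phi>: "\<phi> \<in> mod_iso R N M"
    and L: "submodule L R N" and x: "x \<in> carrier N"
  shows "x \<in> closure_in R \<M> cl N L \<longleftrightarrow> \<phi> x \<in> cl M (\<phi> ` L)"
proof
  assume "\<phi> x \<in> cl M (\<phi> ` L)"
  then show "x \<in> closure_in R \<M> cl N L" using M \<phi> x by (auto simp: closure_in_def)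
next
  assume "x \<in> closure_in R \<M> cl N L"
  then obtain M' \<phi>' where M': "M' \<in> \<M>" and \<phi>': "\<phi>' \<in> mod_iso R N M'" and mem: "\<phi>' x \<in> cl M' (\<phi>' ` L)"
    by (auto simp: closure_in_def)
  interpret N: module R N by (rule N)
  have modM: "module R M" using mods M by blast
  interpret M: module R M by (rule modM)
  define \<psi> where "\<psi> y = \<phi>' (inv_into (carrier N) \<phi> y)" for y
  have \<psi>: "\<psi> \<in> mod_iso R M M'"
    using mod_iso_comp[OF mod_iso_inv_into[OF N \<phi>] \<phi>'] by (simp add: \<psi>_def[abs_def])
  have hom: "\<phi> \<in> mod_hom R N M" and inj: "inj_on \<phi> (carrier N)"
    using \<phi> by (auto simp: mod_iso_def bij_betw_def)
  have \<psi>\<phi>: "\<psi> (\<phi> y) = \<phi>' y" if "y \<in> carrier N" for y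
    using that inj by (simp add: \<psi>_def)
  have sub: "L \<subseteq> carrier N" by (rule N.submoduleE(1)[OF L])
  have L': "submodule (\<phi> ` L) R M" by (rule image_submodule[OF N modM hom L])
  have "\<psi> ` (\<phi> ` L) = \<phi>' ` L" unfolding image_image using sub \<psi>\<phi> by (intro image_cong) auto
  moreover have "cl M' (\<psi> ` (\<phi> ` L)) = \<psi> ` cl M (\<phi> ` L)"
    by (rule cl[unfolded closure_operation_def, THEN conjunct2, THEN conjunct1, rule_format, OF M M' \<psi> L'])
  ultimately have "\<psi> (\<phi> x) \<in> \<psi> ` cl M (\<phi> ` L)" using mem x \<psi>\<phi> by simp
  moreover have "submodule (cl M (\<phi> ` L)) R M"
    using cl M L' by (simp add: closure_operation_def)
  then have "cl M (\<phi> ` L) \<subseteq> carrier M" by (rule M.submoduleE(1))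
  moreover have "inj_on \<psi> (carrier M)" using \<psi> by (simp add: mod_iso_def bij_betw_def)
  ultimately show "\<phi> x \<in> cl M (\<phi> ` L)"
    using mod_homD(1)[OF hom x] by (simp add: inj_on_image_mem_iff)
qed

lemma closure_in_submodule:
  assumes cl: "closure_operation R \<M> cl" and mods: "\<forall>M\<in>\<M>. module R M"
    and N: "in_class R \<M> N" and L: "submodule L R N"
  shows "submodule (closure_in R \<M> cl N L) R N"
proof -
  obtain M \<phi> where modN: "module R N" and M: "M \<in> \<M>" and \<phi>: "\<phi> \<in> mod_iso R N M"
    using N by (auto simp: in_class_def)
  have modM: "module R M" using mods M by blast
  have hom: "\<phi> \<in> mod_hom R N M" using \<phi> by (simp add: mod_iso_def)
  have "submodule (cl M (\<phi> ` L)) R M"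
    using cl M image_submodule[OF modN modM hom L] by (simp add: closure_operation_def)
  note vimage_submodule[OF modN modM hom this]
  moreover have "closure_in R \<M> cl N L \<subseteq> carrier N" by (auto simp: closure_in_def)
  then have "closure_in R \<M> cl N L = {x \<in> carrier N. \<phi> x \<in> cl M (\<phi> ` L)}"
    using closure_in_iff[OF cl mods modN M \<phi> L] by blast
  ultimately show ?thesis by simp
qed

text \<open>
  For a residual closure the closure of the kernel of a surjection is the preimage of the closure
  of zero.  Residuality is this statement for a projection \<open>M \<rightarrow> M/L\<close> with \<open>M\<close> in the class;
  any other surjection differs from such a projection by isomorphisms of source and target.
\<close>

lemma residual_closure_kernel:
  assumes cl: "closure_operation R \<M> cl" and res: "residual R \<M> cl"
    and cls: "sub_quot_closed_class R \<M>"
    and N: "in_class R \<M> N" and N': "in_class R \<M> N'"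
    and p: "p \<in> mod_hom R N N'" "p ` carrier N = carrier N'"
    and K: "K = {x \<in> carrier N. p x = \<zero>\<^bsub>N'\<^esub>}"
  shows "closure_in R \<M> cl N K = {x \<in> carrier N. p x \<in> zero_closure R \<M> cl N'}"
proof -
  have mods: "\<forall>M\<in>\<M>. module R M" using cls by (simp add: sub_quot_closed_class_def)
  obtain M \<phi> where modN: "module R N" and M: "M \<in> \<M>" and \<phi>: "\<phi> \<in> mod_iso R N M"
    using N by (auto simp: in_class_def)
  obtain M' \<phi>' where modN': "module R N'" and M': "M' \<in> \<M>" and \<phi>': "\<phi>' \<in> mod_iso R N' M'"
    using N' by (auto simp: in_class_def)
  have modM: "module R M" and modM': "module R M'" using mods M M' by blast+
  have hom: "\<phi> \<in> mod_hom R N M" and inj: "inj_on \<phi> (carrier N)" and onto: "\<phi> ` carrier N = carrier M"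
    using \<phi> by (auto simp: mod_iso_def bij_betw_def)
  have hom': "\<phi>' \<in> mod_hom R N' M'" and inj': "inj_on \<phi>' (carrier N')"
    and onto': "\<phi>' ` carrier N' = carrier M'"
    using \<phi>' by (auto simp: mod_iso_def bij_betw_def)
  have zero': "\<phi>' y = \<zero>\<^bsub>M'\<^esub> \<longleftrightarrow> y = \<zero>\<^bsub>N'\<^esub>" if "y \<in> carrier N'" for y
    using mod_hom_zero[OF modN' modM' hom'] inj' that
      submodule_zero[OF module.carrier_is_submodule[OF modN']]
      inj_on_eq_iff[of \<phi>' "carrier N'" y "\<zero>\<^bsub>N'\<^esub>"] by auto
  have subK: "submodule K R N"
    using vimage_submodule[OF modN modN' p(1) zero_submodule[OF modN']] by (simp add: K)
  define L where "L = \<phi> ` K"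
  have L: "submodule L R M" unfolding L_def by (rule image_submodule[OF modN modM hom subK])
  \<comment> \<open>The surjection \<open>p\<close>, transported to the members \<open>M\<close> and \<open>M'\<close> of the class.\<close>
  define q where "q y = \<phi>' (p (inv_into (carrier N) \<phi> y))" for y
  have q\<phi>: "q (\<phi> x) = \<phi>' (p x)" if "x \<in> carrier N" for x
    using that inj by (simp add: q_def)
  have inv: "inv_into (carrier N) \<phi> \<in> mod_hom R M N"
    using mod_iso_inv_into[OF modN \<phi>] by (simp add: mod_iso_def)
  have q: "q \<in> mod_hom R M M'"
    using mod_hom_comp[OF mod_hom_comp[OF inv p(1)] hom'] by (simp add: q_def[abs_def])
  have q_onto: "q ` carrier M = carrier M'"
    unfolding onto[symmetric] onto'[symmetric] p(2)[symmetric] image_image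
    using q\<phi> by (intro image_cong) auto
  have "\<phi> x \<in> L \<longleftrightarrow> x \<in> K" if "x \<in> carrier N" for x
    unfolding L_def using that inj by (intro inj_on_image_mem_iff[of _ "carrier N"]) (auto simp: K)
  moreover have "x \<in> K \<longleftrightarrow> q (\<phi> x) = \<zero>\<^bsub>M'\<^esub>" if "x \<in> carrier N" for x
    using that zero' mod_homD(1)[OF p(1)] by (simp add: K q\<phi>)
  moreover have "L \<subseteq> carrier M" using onto by (auto simp: L_def K)
  ultimately have kerq: "L = {y \<in> carrier M. q y = \<zero>\<^bsub>M'\<^esub>}"
    unfolding onto[symmetric] by auto
  obtain t where t: "t \<in> mod_iso R (quot_module R M L) M'" and tq: "\<And>y. y \<in> carrier M \<Longrightarrow> t (L +>\<^bsub>M\<^esub> y) = q y"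
    using quot_iso[OF modM modM' q q_onto L kerq] by blast
  have "in_class R \<M> (quot_module R M L)"
    using cls M L by (simp add: sub_quot_closed_class_def)
  then have modQ: "module R (quot_module R M L)" by (simp add: in_class_def)
  have zQ: "\<zero>\<^bsub>quot_module R M L\<^esub> = L" by (simp add: quot_module_def)
  have zL: "submodule {L} R (quot_module R M L)" using zero_submodule[OF modQ] by (simp add: zQ)
  have tL: "t ` {L} = {\<zero>\<^bsub>M'\<^esub>}"
    using mod_hom_zero[OF modQ modM', of t] t by (simp add: zQ mod_iso_def)
  interpret M: module R M by (rule modM)
  have "L +>\<^bsub>M\<^esub> y = L" if "y \<in> L" for y
    using that M.a_coset_join2[OF _ submodule.axioms(1)[OF L]] M.submoduleE(1)[OF L] by blast
  then have \<pi>L: "(\<lambda>y. L +>\<^bsub>M\<^esub> y) ` L = {L}" using submodule_zero[OF L] by force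
  have "x \<in> closure_in R \<M> cl N K \<longleftrightarrow> p x \<in> zero_closure R \<M> cl N'" if x: "x \<in> carrier N" for x
  proof -
    have \<phi>x: "\<phi> x \<in> carrier M" and px: "p x \<in> carrier N'"
      using mod_homD(1)[OF hom x] mod_homD(1)[OF p(1) x] .
    have Lx: "L +>\<^bsub>M\<^esub> \<phi> x \<in> carrier (quot_module R M L)"
      using mod_homD(1)[OF quot_projection(1)[OF modM L] \<phi>x] .
    have "x \<in> closure_in R \<M> cl N K \<longleftrightarrow> \<phi> x \<in> cl M L"
      unfolding L_def by (rule closure_in_iff[OF cl mods modN M \<phi> subK x])
    also have "\<dots> \<longleftrightarrow> L +>\<^bsub>M\<^esub> \<phi> x \<in> closure_in R \<M> cl (quot_module R M L) {L}"
    proof -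
      have "cl M L = {y \<in> carrier M.
          L +>\<^bsub>M\<^esub> y \<in> closure_in R \<M> cl (quot_module R M L) ((\<lambda>y. L +>\<^bsub>M\<^esub> y) ` L)}"
        using res M L unfolding residual_def by blast
      then show ?thesis unfolding \<pi>L using \<phi>x by blast
    qed
    also have "\<dots> \<longleftrightarrow> t (L +>\<^bsub>M\<^esub> \<phi> x) \<in> cl M' {\<zero>\<^bsub>M'\<^esub>}"
      using closure_in_iff[OF cl mods modQ M' t zL Lx] unfolding tL .
    also have "t (L +>\<^bsub>M\<^esub> \<phi> x) = \<phi>' (p x)" using tq[OF \<phi>x] q\<phi>[OF x] by simp
    also have "\<phi>' (p x) \<in> cl M' {\<zero>\<^bsub>M'\<^esub>} \<longleftrightarrow> p x \<in> zero_closure R \<M> cl N'"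
      using closure_in_iff[OF cl mods modN' M' \<phi>' zero_submodule[OF modN'] px]
        mod_hom_zero[OF modN' modM' hom'] by (simp add: zero_closure_def)
    finally show ?thesis .
  qed
  moreover have "closure_in R \<M> cl N K \<subseteq> carrier N" by (auto simp: closure_in_def)
  ultimately show ?thesis by blast
qed


section \<open>The dual of a residual closure\<close>

theorem proposition3p2:
  fixes R :: "('r, 'x) ring_scheme"
    and \<mm> :: "'r set"
    and E :: "('r, 'e) module"
    and \<M> :: "('r, 'u) module set"
    and cl :: "('r, 'u) module \<Rightarrow> 'u set \<Rightarrow> 'u set"
    and \<alpha> :: "('r, 'a \<Rightarrow> 'e) module \<Rightarrow> ('a \<Rightarrow> 'e) set"
    and A :: "'a set"
    and B :: "('r, 'a) module"
  assumes "complete_noetherian_local_ring R \<mm>"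
    and "injective_hull R (residue_field_module R \<mm>) E"
    and "sub_quot_closed_class R \<M>"
    and "\<forall>M\<in>\<M>. matlis_dualizable R E M"
    and "closure_operation R \<M> cl"
    and "residual R \<M> cl"
    and "\<alpha> = zero_closure R \<M> cl"
    and "in_dual_class R E \<M> B"
    and "submodule A R B"
    and "in_dual_class R E \<M> (B\<lparr>carrier := A\<rparr>)"
  shows "smile_dual R E \<alpha> (B\<lparr>carrier := A\<rparr>) =
    smile_dual_closure R E (closure_in R \<M> cl) A B"
proof -
  let ?A = "B\<lparr>carrier := A\<rparr>"
  let ?DA = "matlis_dual R E ?A" and ?DB = "matlis_dual R E B"
  have inj: "injective_module TYPE('r) R E"
    using assms(2) unfolding injective_hull_def by (rule conjunct1)
  then have E: "module R E" unfolding injective_module_def by (rule conjunct1)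
  have mods: "\<forall>M\<in>\<M>. module R M" using assms(3) by (simp add: sub_quot_closed_class_def)
  have B: "module R B" and A: "module R ?A" using assms(8,10) by (auto simp: in_dual_class_def)
  interpret B: module R B by (rule B)
  have sub: "A \<subseteq> carrier B" by (rule B.submoduleE(1)[OF assms(9)])
  have DA: "in_class R \<M> ?DA" and DB: "in_class R \<M> ?DB"
    by (rule in_dual_class_dual[OF E mods assms(4)], fact)+
  have modDA: "module R ?DA" by (rule matlis_dual_module[OF E A])
  define K where "K = quot_dual R E B A"
  define Z where "Z = zero_closure R \<M> cl ?DA"
  have K_ann: "K = {f \<in> carrier ?DB. \<forall>a\<in>A. f a = \<zero>\<^bsub>E\<^esub>}"
    unfolding K_def by (rule quot_dual_eq_annihilator[OF E B assms(9)])
  then have K: "K = {f \<in> carrier ?DB. restrict f A = \<zero>\<^bsub>?DA\<^esub>}"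
    by (auto simp: matlis_dual_sel(4) restrict_def fun_eq_iff)
  note res = restrict_hom[OF B assms(9), of E] and onto = restrict_surj[OF inj B assms(9)]
  have clK: "closure_in R \<M> cl ?DB K = {f \<in> carrier ?DB. restrict f A \<in> Z}"
    unfolding Z_def by (rule residual_closure_kernel[OF assms(5,6,3) DB DA res onto K])
  have subZ: "submodule Z R ?DA"
    unfolding Z_def zero_closure_def
    by (rule closure_in_submodule[OF assms(5) mods DA zero_submodule[OF modDA]])
  have subK: "submodule K R ?DB"
    using vimage_submodule[OF matlis_dual_module[OF E B] modDA res zero_submodule[OF modDA]]
    by (simp add: K)
  have lhs: "smile_dual R E \<alpha> ?A = {x \<in> A. \<forall>g\<in>Z. g x = \<zero>\<^bsub>E\<^esub>}"
    using dual_quot_dual_eq_annihilator[OF E A subZ] by (simp add: smile_dual_def assms(7) Z_def)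
  have rhs: "smile_dual_closure R E (closure_in R \<M> cl) A B =
      {x \<in> carrier B. \<forall>f\<in>carrier ?DB. restrict f A \<in> Z \<longrightarrow> f x = \<zero>\<^bsub>E\<^esub>}"
    using dual_quot_dual_eq_annihilator[OF E B closure_in_submodule[OF assms(5) mods DB subK]]
    by (auto simp: smile_dual_closure_def K_def[symmetric] clK)
  show ?thesis
    unfolding lhs rhs
  proof (intro equalityI subsetI CollectI conjI ballI impI)
    fix x f assume "x \<in> {x \<in> A. \<forall>g\<in>Z. g x = \<zero>\<^bsub>E\<^esub>}" and "restrict f A \<in> Z"
    then show "f x = \<zero>\<^bsub>E\<^esub>" by auto
  next
    fix x assume x: "x \<in> {x \<in> carrier B. \<forall>f\<in>carrier ?DB. restrict f A \<in> Z \<longrightarrow> f x = \<zero>\<^bsub>E\<^esub>}"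
    \<comment> \<open>Functionals that vanish on \<open>A\<close> restrict to zero, which lies in \<open>Z\<close>.\<close>
    have "f x = \<zero>\<^bsub>E\<^esub>" if "f \<in> carrier ?DB" "\<And>a. a \<in> A \<Longrightarrow> f a = \<zero>\<^bsub>E\<^esub>" for f
    proof -
      have "f \<in> K" using that by (simp add: K_ann)
      then have "restrict f A = \<zero>\<^bsub>?DA\<^esub>" by (simp add: K)
      then show ?thesis using x that(1) submodule_zero[OF subZ] by simp
    qed
    then show xA: "x \<in> A"
      using x in_dual_class_dualizable[OF E mods assms(4)] assms(8,10)
      by (intro double_annihilator[OF inj B assms(9)]) auto
    fix g assume g: "g \<in> Z"
    then have "g \<in> carrier ?DA" using module.submoduleE(1)[OF modDA subZ] by blast
    then obtain f where "f \<in> carrier ?DB" "g = restrict f A" using onto by blast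
    then show "g x = \<zero>\<^bsub>E\<^esub>" using x g xA by simp
  qed (use sub in auto)
qed

end
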